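(* Let $q$ be a prime with $q\equiv 1\pmod 4$. For groups $X,Y$ of order $4q$ let $N(X,Y)$ be the number of isomorphism classes of skew braces $(B,+,\circ)$ with $(B,+)\cong X$ and $(B,\circ)\cong Y$. Then: (1) For each of $X=\mathbb{Z}_q\rtimes_{-1}\mathbb{Z}_4$ and $X=\mathbb{Z}_2\times(\mathbb{Z}_q\rtimes_{-1}\mathbb{Z}_2)$: $N(X,\mathbb{Z}_{4q})=2$, $N(X,\mathbb{Z}_q\rtimes_{-1}\mathbb{Z}_4)=2$, $N(X,\mathbb{Z}_q\rtimes_h\mathbb{Z}_4)=2$, $N(X,\mathbb{Z}_2^2\times\mathbb{Z}_q)=2$, $N(X,\mathbb{Z}_2\times(\mathbb{Z}_q\rtimes_{-1}\mathbb{Z}_2))=4$. (2) For $X=\mathbb{Z}_q\rtimes_h\mathbb{Z}_4$: $N(X,\mathbb{Z}_{4q})=2$, $N(X,\mathbb{Z}_q\rtimes_{-1}\mathbb{Z}_4)=2$, $N(X,\mathbb{Z}_q\rtimes_h\mathbb{Z}_4)=4$, $N(X,\mathbb{Z}_2^2\times\mathbb{Z}_q)=0$, $N(X,\mathbb{Z}_2\times(\mathbb{Z}_q\rtimes_{-1}\mathbb{Z}_2))=0$.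
   Context: A skew (left) brace is a triple $(B,+,\circ)$ where $(B,+)$ and $(B,\circ)$ are groups (not necessarily abelian) such that $a\circ(b+c)=a\circ b-a+a\circ c$ for all $a,b,c\in B$; isomorphisms are bijections preserving both operations. Fix an element $h$ of order $4$ in $\mathbb{Z}_q^\times$. For $u\in\{h,-1\}$, $\mathbb{Z}_q\rtimes_u\mathbb{Z}_4=\langle\sigma,\tau\mid\tau^q=\sigma^4=1,\ \sigma\tau\sigma^{-1}=\tau^u\rangle$, and $\mathbb{Z}_2\times(\mathbb{Z}_q\rtimes_{-1}\mathbb{Z}_2)=\langle\sigma,\tau,\epsilon\mid\sigma^2=\tau^2=\epsilon^q=1,\ [\epsilon,\tau]=[\tau,\sigma]=1,\ \sigma\epsilon\sigma^{-1}=\epsilon^{-1}\rangle$. *)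

theory Defs
  imports "HOL-Number_Theory.Number_Theory"
begin

locale skew_brace = add: group A + circ: group C
  for A :: "'a monoid" and C :: "'a monoid" +
  assumes carrier_eq: "carrier C = carrier A"
    and brace: "\<lbrakk>a \<in> carrier A; b \<in> carrier A; c \<in> carrier A\<rbrakk> \<Longrightarrow>
      a \<otimes>\<^bsub>C\<^esub> (b \<otimes>\<^bsub>A\<^esub> c) = (a \<otimes>\<^bsub>C\<^esub> b) \<otimes>\<^bsub>A\<^esub> inv\<^bsub>A\<^esub> a \<otimes>\<^bsub>A\<^esub> (a \<otimes>\<^bsub>C\<^esub> c)"

definition skew_brace_isomorphic :: "'a monoid \<times> 'a monoid \<Rightarrow> 'b monoid \<times> 'b monoid \<Rightarrow> bool" where
  "skew_brace_isomorphic B B' \<longleftrightarrow>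
     (\<exists>f. f \<in> iso (fst B) (fst B') \<and> f \<in> iso (snd B) (snd B'))"

(* Every finite skew brace is isomorphic to one whose carrier is a set of natural numbers,
   so for finite X and Y the braces below represent all isomorphism classes. *)
definition skew_braces :: "'x monoid \<Rightarrow> 'y monoid \<Rightarrow> (nat monoid \<times> nat monoid) set" where
  "skew_braces X Y = {(A, C). skew_brace A C \<and> A \<cong> X \<and> C \<cong> Y}"

definition skew_brace_iso_rel ::
  "'x monoid \<Rightarrow> 'y monoid \<Rightarrow> ((nat monoid \<times> nat monoid) \<times> (nat monoid \<times> nat monoid)) set" where
  "skew_brace_iso_rel X Y =
     {(B, B'). B \<in> skew_braces X Y \<and> B' \<in> skew_braces X Y \<and> skew_brace_isomorphic B B'}"

definition num_skew_braces :: "'x monoid \<Rightarrow> 'y monoid \<Rightarrow> nat" where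
  "num_skew_braces X Y = card (skew_braces X Y // skew_brace_iso_rel X Y)"

definition semidirect_product ::
  "('a, 'm) monoid_scheme \<Rightarrow> ('b, 'n) monoid_scheme \<Rightarrow> ('b \<Rightarrow> 'a \<Rightarrow> 'a) \<Rightarrow> ('a \<times> 'b) monoid" where
  "semidirect_product N H \<phi> =
     \<lparr>carrier = carrier N \<times> carrier H,
      mult = (\<lambda>(x, i) (y, j). (x \<otimes>\<^bsub>N\<^esub> \<phi> i y, i \<otimes>\<^bsub>H\<^esub> j)),
      one = (\<one>\<^bsub>N\<^esub>, \<one>\<^bsub>H\<^esub>)\<rparr>"

(* The split extension of Z_q by Z_m in which the generator sigma = (0, 1) of Z_m acts on
   Z_q by multiplication by u; with tau = (1, 0) this is
   < sigma, tau | tau^q = sigma^m = 1, sigma tau sigma^-1 = tau^u >.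
   It is a group only when u^m = 1 modulo q. *)
definition cyclic_semidirect :: "nat \<Rightarrow> nat \<Rightarrow> int \<Rightarrow> (int \<times> int) monoid" where
  "cyclic_semidirect q m u =
     semidirect_product (integer_mod_group q) (integer_mod_group m)
       (\<lambda>i x. (u ^ nat i * x) mod int q)"

lemma skew_brace_isomorphic_refl: "skew_brace_isomorphic B B"
  unfolding skew_brace_isomorphic_def by (rule exI[of _ "\<lambda>x. x"]) (auto simp: iso_def hom_def bij_betw_def)

lemma skew_brace_isomorphic_sym:
  assumes "skew_brace A C" "skew_brace A' C'" "skew_brace_isomorphic (A, C) (A', C')"
  shows "skew_brace_isomorphic (A', C') (A, C)"
proof -
  interpret B: skew_brace A C by fact
  obtain f where f: "f \<in> iso A A'" "f \<in> iso C C'"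
    using assms(3) by (auto simp: skew_brace_isomorphic_def)
  have "inv_into (carrier A) f \<in> iso A' A" "inv_into (carrier A) f \<in> iso C' C"
    using B.add.iso_set_sym[OF f(1)] B.circ.iso_set_sym[OF f(2)] by (simp_all add: B.carrier_eq)
  then show ?thesis by (auto simp: skew_brace_isomorphic_def)
qed

lemma skew_brace_isomorphic_trans:
  assumes "skew_brace_isomorphic B B'" "skew_brace_isomorphic B' B''"
  shows "skew_brace_isomorphic B B''"
  using assms unfolding skew_brace_isomorphic_def by (meson iso_set_trans)

lemma equiv_skew_brace_iso_rel: "equiv (skew_braces X Y) (skew_brace_iso_rel X Y)"
proof (rule equivI)
  show "skew_brace_iso_rel X Y \<subseteq> skew_braces X Y \<times> skew_braces X Y"
    by (auto simp: skew_brace_iso_rel_def)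
  show "refl_on (skew_braces X Y) (skew_brace_iso_rel X Y)"
    by (auto simp: refl_on_def skew_brace_iso_rel_def skew_brace_isomorphic_refl)
  show "sym (skew_brace_iso_rel X Y)"
    by (auto simp: sym_def skew_brace_iso_rel_def skew_braces_def intro: skew_brace_isomorphic_sym)
  show "trans (skew_brace_iso_rel X Y)"
    unfolding trans_def skew_brace_iso_rel_def using skew_brace_isomorphic_trans by blast
qed

(* Hence num_skew_braces is a genuine count: the value 0 means that no such brace exists. *)
lemma finite_skew_brace_classes:
  assumes fin: "finite (carrier X)"
  shows "finite (skew_braces X Y // skew_brace_iso_rel X Y)"
proof -
  define n where "n = card (carrier X)"
  define T :: "(nat \<times> nat \<Rightarrow> nat) set" where "T = ({..<n} \<times> {..<n}) \<rightarrow>\<^sub>E {..<n}"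
  have finT: "finite (T \<times> T)" unfolding T_def by (intro finite_SigmaI finite_PiE) auto
  define P where "P B g t \<longleftrightarrow> bij_betw g {..<n} (carrier (fst B)) \<and>
      (\<forall>i<n. \<forall>j<n. g i \<otimes>\<^bsub>fst B\<^esub> g j = g (fst t (i, j)) \<and> g i \<otimes>\<^bsub>snd B\<^esub> g j = g (snd t (i, j)))"
    for B :: "nat monoid \<times> nat monoid" and g :: "nat \<Rightarrow> nat"
      and t :: "(nat \<times> nat \<Rightarrow> nat) \<times> (nat \<times> nat \<Rightarrow> nat)"
  have ex: "\<exists>t\<in>T \<times> T. \<exists>g. P B g t" if B: "B \<in> skew_braces X Y" for B
  proof -
    obtain A C where AC: "B = (A, C)" "skew_brace A C" "A \<cong> X"
      using B by (auto simp: skew_braces_def)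
    interpret B: skew_brace A C by fact
    obtain k where "bij_betw k (carrier A) (carrier X)"
      using AC(3) by (auto simp: is_iso_def iso_def)
    then have "finite (carrier A)" "card (carrier A) = n"
      using fin bij_betw_finite bij_betw_same_card by (auto simp: n_def)
    then obtain g where g: "bij_betw g {..<n} (carrier A)"
      using ex_bij_betw_nat_finite[of "carrier A"] by (auto simp: atLeast0LessThan)
    define gi where "gi = inv_into {..<n} g"
    have gi: "gi x < n" "g (gi x) = x" if "x \<in> carrier A" for x
      using bij_betw_inv_into[OF g] that bij_betw_inv_into_right[OF g that]
      by (auto simp: gi_def bij_betw_def)
    have gc: "g i \<in> carrier A" if "i < n" for i using g that by (auto simp: bij_betw_def)
    define s where "s = (restrict (\<lambda>(i, j). gi (g i \<otimes>\<^bsub>A\<^esub> g j)) ({..<n} \<times> {..<n}),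
       restrict (\<lambda>(i, j). gi (g i \<otimes>\<^bsub>C\<^esub> g j)) ({..<n} \<times> {..<n}))"
    have closed: "g i \<otimes>\<^bsub>A\<^esub> g j \<in> carrier A" "g i \<otimes>\<^bsub>C\<^esub> g j \<in> carrier A"
      if "i < n" "j < n" for i j
      using gc that B.circ.m_closed B.carrier_eq by auto
    have "s \<in> T \<times> T" by (auto simp: s_def T_def gi closed)
    moreover have "P B g s" using g by (auto simp: P_def AC(1) s_def gi closed)
    ultimately show ?thesis by blast
  qed
  have iso: "skew_brace_isomorphic B B'"
    if B: "B \<in> skew_braces X Y" and B': "B' \<in> skew_braces X Y"
      and P: "P B g t" and P': "P B' g' t" and t: "t \<in> T \<times> T" for B B' g g' t
  proof -
    obtain A C A' C' where AC: "B = (A, C)" "B' = (A', C')" "skew_brace A C" "skew_brace A' C'"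
      using B B' by (auto simp: skew_braces_def)
    interpret B: skew_brace A C by fact
    interpret B': skew_brace A' C' by fact
    have g: "bij_betw g {..<n} (carrier A)" and g': "bij_betw g' {..<n} (carrier A')"
      using P P' by (auto simp: P_def AC)
    define gi where "gi = inv_into {..<n} g"
    have gi: "bij_betw gi (carrier A) {..<n}" unfolding gi_def by (rule bij_betw_inv_into[OF g])
    have gig: "gi (g i) = i" if "i < n" for i
      unfolding gi_def using bij_betw_inv_into_left[OF g] that by simp
    have tT: "fst t (i, j) < n" "snd t (i, j) < n" if "i < n" "j < n" for i j
      using t that by (auto simp: T_def PiE_def Pi_def)
    have bij: "bij_betw (g' \<circ> gi) (carrier A) (carrier A')"
      by (rule bij_betw_trans[OF gi g'])
    have img: "carrier A = g ` {..<n}" using g by (simp add: bij_betw_def)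
    have "g' \<circ> gi \<in> hom A A'"
      using bij P P' tT
      by (intro homI) (auto simp: img P_def AC gig dest: bij_betwE)
    moreover have "g' \<circ> gi \<in> hom C C'"
      using bij P P' tT
      by (intro homI) (auto simp: B.carrier_eq B'.carrier_eq img P_def AC gig dest: bij_betwE)
    ultimately show ?thesis
      using bij unfolding skew_brace_isomorphic_def iso_def AC
      by (intro exI[of _ "g' \<circ> gi"]) (auto simp: B.carrier_eq B'.carrier_eq)
  qed
  define F where "F t = skew_brace_iso_rel X Y `` {SOME B. B \<in> skew_braces X Y \<and> (\<exists>g. P B g t)}" for t
  have "skew_braces X Y // skew_brace_iso_rel X Y \<subseteq> F ` (T \<times> T)"
  proof
    fix c assume "c \<in> skew_braces X Y // skew_brace_iso_rel X Y"
    then obtain B where B: "B \<in> skew_braces X Y" "c = skew_brace_iso_rel X Y `` {B}"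
      by (auto simp: quotient_def)
    obtain t g where t: "t \<in> T \<times> T" "P B g t" using ex[OF B(1)] by blast
    define B' where "B' = (SOME B. B \<in> skew_braces X Y \<and> (\<exists>g. P B g t))"
    have "B' \<in> skew_braces X Y \<and> (\<exists>g. P B' g t)"
      unfolding B'_def by (rule someI[of _ B]) (use B t in blast)
    then have "(B, B') \<in> skew_brace_iso_rel X Y"
      using iso[OF B(1) _ t(2) _ t(1), of B'] B(1) unfolding skew_brace_iso_rel_def by blast
    then have "c = F t"
      unfolding F_def B(2) B'_def[symmetric]
      using equiv_class_eq[OF equiv_skew_brace_iso_rel] by blast
    then show "c \<in> F ` (T \<times> T)" using t(1) by blast
  qed
  then show ?thesis using finT finite_surj by blast
qed

lemma group_cyclic_semidirect:
  assumes q: "q > 0" and m: "m > 0" and u: "[u ^ m = 1] (mod int q)"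
  shows "group (cyclic_semidirect q m u)"
proof -
  let ?q = "int q" and ?m = "int m"
  have pw: "[u ^ nat (k mod ?m) = u ^ nat k] (mod ?q)" if "0 \<le> k" for k
  proof -
    have "nat k = m * nat (k div ?m) + nat (k mod ?m)"
      using that m by (metis nat_int nat_mod_distrib nat_div_distrib of_nat_0_le_iff mult_div_mod_eq)
    then have "u ^ nat k = (u ^ m) ^ nat (k div ?m) * u ^ nat (k mod ?m)"
      by (metis power_add power_mult)
    moreover have "[(u ^ m) ^ nat (k div ?m) * u ^ nat (k mod ?m) = 1 ^ nat (k div ?m) * u ^ nat (k mod ?m)] (mod ?q)"
      by (intro cong_mult cong_pow u cong_refl)
    ultimately show ?thesis by (simp add: cong_sym)
  qed
  have inner: "(x + a * (b mod ?q)) mod ?q = (x + a * b) mod ?q" for x a b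
    by (metis mod_add_right_eq mod_mult_right_eq)
  have assoc: "((x + (u ^ nat i * y) mod ?q) mod ?q + (u ^ nat ((i + j) mod ?m) * z) mod ?q) mod ?q
      = (x + (u ^ nat i * ((y + (u ^ nat j * z) mod ?q) mod ?q)) mod ?q) mod ?q"
    if "0 \<le> i" "0 \<le> j" for x y z i j
  proof -
    have "[(x + (u ^ nat i * y) mod ?q) mod ?q + (u ^ nat ((i + j) mod ?m) * z) mod ?q
        = (x + u ^ nat i * y) + u ^ nat (i + j) * z] (mod ?q)"
      using that by (intro cong_add cong_mult cong_refl pw cong_trans[OF cong_mod_left[THEN iffD2, OF cong_refl]])
        (auto simp: cong_def mod_simps intro: mod_mult_cong pw[unfolded cong_def])
    also have "(x + u ^ nat i * y) + u ^ nat (i + j) * z = x + u ^ nat i * (y + u ^ nat j * z)"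
      using that by (simp add: nat_add_distrib power_add algebra_simps)
    finally show ?thesis by (simp add: cong_def mod_simps)
  qed
  show ?thesis
  proof (rule groupI, goal_cases)
    case (1 x y)
    then show ?case using q m
      by (auto simp: cyclic_semidirect_def semidirect_product_def carrier_integer_mod_group)
  next
    case 2
    then show ?case using q m
      by (auto simp: cyclic_semidirect_def semidirect_product_def carrier_integer_mod_group)
  next
    case (3 x y z)
    then show ?case using q m assoc
      by (auto simp: cyclic_semidirect_def semidirect_product_def carrier_integer_mod_group
          mod_simps inner add.assoc)
  next
    case (4 x)
    then show ?case using q m
      by (auto simp: cyclic_semidirect_def semidirect_product_def carrier_integer_mod_group)
  next
    case (5 x)
    then obtain a i where x: "x = (a, i)" "0 \<le> a" "a < ?q" "0 \<le> i" "i < ?m"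
      using q m by (auto simp: cyclic_semidirect_def semidirect_product_def carrier_integer_mod_group)
    let ?j = "(- i) mod ?m"
    show ?case using x q m
      by (intro bexI[of _ "((- (u ^ nat ?j * a)) mod ?q, ?j)"])
        (auto simp: cyclic_semidirect_def semidirect_product_def carrier_integer_mod_group mod_simps)
  qed
qed

lemma cyclic_semidirect_conj:
  assumes "q > 1" "m > 1" "[u ^ m = 1] (mod int q)"
  shows "(0, 1) \<otimes>\<^bsub>cyclic_semidirect q m u\<^esub> (1, 0) \<otimes>\<^bsub>cyclic_semidirect q m u\<^esub>
     inv\<^bsub>cyclic_semidirect q m u\<^esub> (0, 1) = (u mod int q, 0)"
proof -
  let ?G = "cyclic_semidirect q m u"
  interpret G: group ?G using assms by (intro group_cyclic_semidirect) auto
  have c: "(0, 1) \<in> carrier ?G" "(1, 0) \<in> carrier ?G" "(u mod int q, 0) \<in> carrier ?G"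
    using assms by (auto simp: cyclic_semidirect_def semidirect_product_def carrier_integer_mod_group)
  have "(0, 1) \<otimes>\<^bsub>?G\<^esub> (1, 0) = (u mod int q, 0) \<otimes>\<^bsub>?G\<^esub> (0, 1)"
    using assms by (auto simp: cyclic_semidirect_def semidirect_product_def)
  then show ?thesis using c by (simp add: G.m_assoc)
qed

end

(* Since q is at least 5, every group of order 4q here is a split extension of Z_q by a group K of
   order 4, acting through a character with values in the units modulo q.  For an additive group
   Z_q x| K with nontrivial character chi, the subgroup Z_q is characteristic, hence invariant under all
   maps lambda_a, hence it is also the normal Sylow q-subgroup of the multiplicative group.  Writing out
   the left translations with the explicit form of the automorphisms, normality leaves exactly two
   possibilities for (x, 0) o (0, m), namely (x, m) and (chi(m) x, m); a cocycle
   computation then moves the multiplicative complement onto K.  So up to isomorphism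
     (x, k) o (y, m) = (w(m) x + psi(k) w(k) y, k o m),   w = 1 or w = chi,
   where K is a brace of order 4 with lambda-invariant character chi and psi is any character of (K, o).
   The multiplicative group is the split extension by psi.  Hence the count is twice the number of
   orbits of the pairs (o, psi) under the automorphisms of K fixing chi, and these automorphisms are at
   most {id, shear}.

   Encoding of K: both groups of order 4 live on pairs of bits, with addition (s, t) + (s', t') =
   (s xor s', t xor t' xor (c and s and s')).  For c = True this is Z_4 with (s, t) standing for s + 2t
   (the carry of the low bits), for c = False it is Z_2^2. *)
theory Submission
  imports Defs "HOL-Library.Countable"
begin

text \<open>The obstacle is that an arbitrary multiplicative group on the carrier comes without
  coordinates. Each left translation, however, is an affine map with three parameters: a unit scalar
  \<open>A\<close>, a coefficient \<open>G\<close> and a shear bit \<open>Z\<close>. Associativity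
  makes \<open>A\<close> and \<open>Z\<close> homomorphisms and \<open>G\<close> a twisted
  derivation; on the Sylow subgroup only the slope \<open>g0\<close> of \<open>G\<close> survives.
  Normality gives \<open>g0 * (g0 - 1) = 0\<close> modulo \<open>q\<close>, and the two roots are
  the two choices of \<open>w\<close>. They are never isomorphic because \<chi> is nontrivial, and
  rescaling the coset of \<open>k\<close> by \<open>w k\<close> shows that the type of the
  multiplicative group does not see the choice.

  Where the values 4 and 0 come from: a quadratic \<chi> allows both groups of order 4 as the
  multiplicative group of K. The nontrivial characters of Z_2^2 give isomorphic split extensions,
  but the automorphisms of K fixing \<chi> have two orbits on them. A quartic \<chi> is injective,
  so K must keep its own addition, which excludes Z_2^2; its four characters stay apart, and the two
  faithful ones give the same group.\<close>

type_synonym bits = "bool \<times> bool"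

section \<open>The two groups of order 4 on pairs of bits\<close>

definition bmult :: "bool \<Rightarrow> bits \<Rightarrow> bits \<Rightarrow> bits" where
  "bmult c k m = (fst k \<noteq> fst m, (snd k \<noteq> snd m) \<noteq> (c \<and> fst k \<and> fst m))"

abbreviation b0 :: bits where "b0 \<equiv> (False, False)"

definition ext4 :: "bool \<Rightarrow> bits monoid" where
  "ext4 c = \<lparr>carrier = UNIV, mult = bmult c, one = b0\<rparr>"

lemma ext4_simps [simp]: "carrier (ext4 c) = UNIV" "\<one>\<^bsub>ext4 c\<^esub> = b0" "k \<otimes>\<^bsub>ext4 c\<^esub> m = bmult c k m"
  by (simp_all add: ext4_def)

lemma bmult_assoc: "bmult c (bmult c k m) n = bmult c k (bmult c m n)"
  by (auto simp: bmult_def)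

lemma bmult_comm: "bmult c k m = bmult c m k"
  by (auto simp: bmult_def)

lemma bmult_b0 [simp]: "bmult c b0 k = k" "bmult c k b0 = k"
  by (auto simp: bmult_def prod_eq_iff)

lemma bmult_4: "bmult c (bmult c k k) (bmult c k k) = b0"
  by (auto simp: bmult_def)

lemma bmult_inverse: "bmult c k (bmult c k (bmult c k k)) = b0"
  by (auto simp: bmult_def)

lemma bmult_cancel [simp]: "bmult c k m = bmult c k n \<longleftrightarrow> m = n"
  by (metis bmult_assoc bmult_comm bmult_inverse bmult_b0(1))

lemma group_ext4: "group (ext4 c)"
proof (rule groupI)
  fix k assume "k \<in> carrier (ext4 c)"
  have "bmult c (bmult c k (bmult c k k)) k = b0" by (metis bmult_comm bmult_inverse)
  then show "\<exists>j\<in>carrier (ext4 c). j \<otimes>\<^bsub>ext4 c\<^esub> k = \<one>\<^bsub>ext4 c\<^esub>"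
    by (intro bexI[of _ "bmult c k (bmult c k k)"]) simp_all
qed (simp_all add: bmult_assoc)

text \<open>For \<open>n = q\<close> this says that taking q-th powers is the identity on the
  quotient of order 4, so that only the Sylow q-subgroup can be killed by \<open>q\<close>.\<close>

lemma ext4_pow: "k [^]\<^bsub>ext4 c\<^esub> (n::nat) = k" if "n mod 4 = 1"
proof -
  interpret group "ext4 c" by (rule group_ext4)
  have four: "k [^]\<^bsub>ext4 c\<^esub> (4::nat) = b0"
    by (simp add: numeral_eq_Suc bmult_assoc) (metis bmult_comm bmult_inverse)
  have "n = 4 * (n div 4) + 1" using that by (metis mult_div_mod_eq)
  then have "k [^]\<^bsub>ext4 c\<^esub> n = (k [^]\<^bsub>ext4 c\<^esub> (4::nat)) [^]\<^bsub>ext4 c\<^esub> (n div 4) \<otimes>\<^bsub>ext4 c\<^esub> k"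
    by (metis UNIV_I ext4_simps(1) nat_pow_eone nat_pow_mult nat_pow_pow)
  moreover have "b0 [^]\<^bsub>ext4 c\<^esub> (n div 4) = b0" using nat_pow_one by simp
  ultimately show ?thesis using four by simp
qed

lemma bits_exhaust: "(\<forall>k::bits. P k) \<longleftrightarrow> P b0 \<and> P (True, False) \<and> P (False, True) \<and> P (True, True)"
  by (metis (full_types) surj_pair)

text \<open>A polynomial congruence is proved below by exhibiting the cofactors \<open>c\<close> of its hypotheses.\<close>

lemma cong_linear1:
  fixes m :: int
  assumes "[a = b] (mod m)" "x - y = c * (a - b)"
  shows "[x = y] (mod m)"
  using assms by (simp add: cong_iff_dvd_diff)

lemma cong_linear2:
  fixes m :: int
  assumes "[a = b] (mod m)" "[a' = b'] (mod m)" "x - y = c * (a - b) + c' * (a' - b')"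
  shows "[x = y] (mod m)"
  using assms by (simp add: cong_iff_dvd_diff)

lemma cong_linear3:
  fixes m :: int
  assumes "[a = b] (mod m)" "[a' = b'] (mod m)" "[a'' = b''] (mod m)"
    "x - y = c * (a - b) + c' * (a' - b') + c'' * (a'' - b'')"
  shows "[x = y] (mod m)"
  using assms by (simp add: cong_iff_dvd_diff)

section \<open>Arithmetic modulo q\<close>

locale prime_1_mod_4 =
  fixes q :: nat
  assumes prime_q: "prime q" and q_mod_4: "q mod 4 = 1"
begin

abbreviation cong_q :: "int \<Rightarrow> int \<Rightarrow> bool" (infix "\<simeq>" 50) where
  "a \<simeq> b \<equiv> [a = b] (mod int q)"

lemma q_ge: "q \<ge> 5"
proof -
  have "q \<noteq> 0" "q \<noteq> 1" using prime_q by (auto intro: Nat.gr0I)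
  moreover have "q \<noteq> 2" "q \<noteq> 3" "q \<noteq> 4" using q_mod_4 by auto
  ultimately show ?thesis by linarith
qed

lemma cong_cancel: "\<not> a \<simeq> 0 \<Longrightarrow> a * x \<simeq> a * y \<longleftrightarrow> x \<simeq> y"
  by (rule cong_mult_lcancel)
    (metis cong_0_iff coprime_commute prime_imp_coprime prime_int_nat_transfer prime_nat_int_transfer prime_q)

lemma cong_mult_0: "a * b \<simeq> 0 \<longleftrightarrow> a \<simeq> 0 \<or> b \<simeq> 0"
  using prime_q by (simp add: cong_0_iff prime_dvd_mult_iff)

lemma cong_inverse:
  assumes "\<not> a \<simeq> 0" obtains i where "a * i \<simeq> 1"
  using assms prime_q
  by (metis cong_0_iff cong_solve_coprime_int coprime_commute prime_imp_coprime prime_nat_int_transfer)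

lemma small_not_0: "0 < a \<Longrightarrow> a < 5 \<Longrightarrow> \<not> a \<simeq> 0"
  using q_ge by (auto simp: cong_0_iff dest: zdvd_imp_le)

lemma not_1_0: "\<not> 1 \<simeq> 0" and not_2_0: "\<not> 2 \<simeq> 0"
  using small_not_0[of 1] small_not_0[of 2] by simp_all

text \<open>Combined with \<open>a ^ q \<simeq> 1\<close> this yields \<open>a \<simeq> 1\<close>: a
  homomorphism into the units modulo \<open>q\<close> is trivial on elements whose q-th power is the
  identity.\<close>

lemma cong_fermat: "a ^ q \<simeq> a"
proof (cases "a \<simeq> 0")
  case True
  then show ?thesis using q_ge by (metis cong_pow cong_sym cong_trans power_0_left not_numeral_le_zero)
next
  case False
  define b where "b = nat (a mod int q)"
  have b: "int b \<simeq> a" using q_ge by (simp add: b_def)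
  have "\<not> q dvd b"
    using False b by (metis cong_0_iff cong_dvd_iff int_dvd_int_iff)
  then have "[b ^ (q - 1) = 1] (mod q)" using fermat_theorem prime_q by simp
  then have "int b ^ (q - 1) \<simeq> 1" by (metis cong_int_iff of_nat_1 of_nat_power)
  then have "int b * int b ^ (q - 1) \<simeq> int b * 1" by (intro cong_mult cong_refl)
  then have "int b ^ q \<simeq> int b" using q_ge by (metis mult.right_neutral not_numeral_le_zero power_eq_if)
  then show ?thesis using b by (meson cong_pow cong_sym cong_trans)
qed

section \<open>Split extensions of Z_q by a group of order 4 and their twisted forms\<close>

definition pt :: "int \<Rightarrow> bits \<Rightarrow> int \<times> bits" where
  "pt x k = (x mod int q, k)"

text \<open>Characters are integer-valued; only their values modulo \<open>q\<close> matter. \<open>twist d w \<alpha>\<close> is the normal form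
  of the multiplicative groups, with \<open>w\<close> trivial or equal to the character of the additive group.\<close>

definition twist :: "bool \<Rightarrow> (bits \<Rightarrow> int) \<Rightarrow> (bits \<Rightarrow> int) \<Rightarrow> (int \<times> bits) monoid" where
  "twist d w \<alpha> = \<lparr>carrier = {0..<int q} \<times> UNIV,
     mult = (\<lambda>(x, k) (y, m). pt (w m * x + \<alpha> k * y) (bmult d k m)), one = (0, b0)\<rparr>"

abbreviation split4 :: "bool \<Rightarrow> (bits \<Rightarrow> int) \<Rightarrow> (int \<times> bits) monoid" where
  "split4 c \<chi> \<equiv> twist c (\<lambda>_. 1) \<chi>"

text \<open>The condition at \<open>b0\<close> excludes the function that vanishes modulo
  \<open>q\<close>; all values are then fourth roots of unity, so a cube serves as an inverse
  throughout.\<close>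

definition char4 :: "bool \<Rightarrow> (bits \<Rightarrow> int) \<Rightarrow> bool" where
  "char4 d w \<longleftrightarrow> w b0 \<simeq> 1 \<and> (\<forall>k m. w (bmult d k m) \<simeq> w k * w m)"

lemma pt_eq_iff: "pt x k = pt y m \<longleftrightarrow> x \<simeq> y \<and> k = m"
  by (auto simp: pt_def cong_def)

lemma pt_eqI: "x \<simeq> y \<Longrightarrow> k = m \<Longrightarrow> pt x k = pt y m"
  by (simp add: pt_eq_iff)

lemma snd_pt [simp]: "snd (pt x k) = k"
  by (simp add: pt_def)

lemma fst_pt: "fst (pt x k) \<simeq> x"
  by (simp add: pt_def)

lemma pt_collapse: "a \<in> {0..<int q} \<times> UNIV \<Longrightarrow> pt (fst a) (snd a) = a"
  by (auto simp: pt_def prod_eq_iff)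

lemma carrier_twist: "carrier (twist d w \<alpha>) = {0..<int q} \<times> UNIV"
  by (simp add: twist_def)

lemma pt_carrier [simp]: "pt x k \<in> carrier (twist d w \<alpha>)"
  using q_ge by (simp add: pt_def carrier_twist)

lemma pt_cases:
  assumes "a \<in> carrier (twist d w \<alpha>)" obtains x k where "a = pt x k"
  using pt_collapse assms by (metis carrier_twist)

lemma one_twist: "\<one>\<^bsub>twist d w \<alpha>\<^esub> = pt 0 b0"
  by (simp add: twist_def pt_def)

lemma pt_mult: "pt x k \<otimes>\<^bsub>twist d w \<alpha>\<^esub> pt y m = pt (w m * x + \<alpha> k * y) (bmult d k m)"
  by (simp add: twist_def pt_def) (metis (no_types, lifting) mod_add_cong mod_mult_right_eq)

text \<open>Equality, not just isomorphism, because first components are reduced modulo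
  \<open>q\<close>. It allows characters to be replaced by congruent standard ones.\<close>

lemma twist_cong:
  assumes "\<And>k. w k \<simeq> w' k" "\<And>k. \<alpha> k \<simeq> \<alpha>' k"
  shows "twist d w \<alpha> = twist d w' \<alpha>'"
proof -
  have "pt (w m * x + \<alpha> k * y) (bmult d k m) = pt (w' m * x + \<alpha>' k * y) (bmult d k m)" for x y k m
    by (intro pt_eqI cong_add cong_mult assms cong_refl refl)
  then show ?thesis by (simp add: twist_def)
qed

lemma card_twist: "card (carrier (twist d w \<alpha>)) = 4 * q"
  by (simp add: carrier_twist card_cartesian_product card_UNIV_unit UNIV_Times_UNIV[symmetric] del: UNIV_Times_UNIV)

lemma finite_twist: "finite (carrier (twist d w \<alpha>))"
  by (simp add: carrier_twist)

lemma char4_const [simp]: "char4 d (\<lambda>_. 1)"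
  by (simp add: char4_def)

lemma char4_b0: "char4 d w \<Longrightarrow> w b0 \<simeq> 1"
  and char4_mult: "char4 d w \<Longrightarrow> w (bmult d k m) \<simeq> w k * w m"
  unfolding char4_def by blast+

lemma char4_times: "char4 d w \<Longrightarrow> char4 d v \<Longrightarrow> char4 d (\<lambda>k. w k * v k)"
  unfolding char4_def
  using cong_mult[of "w b0" 1 "int q" "v b0" 1]
    cong_mult[of "w (bmult d k m)" "w k * w m" "int q" "v (bmult d k m)" "v k * v m" for k m]
  by (simp add: mult_ac del: split_paired_All)

lemma char4_power:
  assumes "char4 d w" shows "char4 d (\<lambda>k. w k ^ n)"
proof (induction n)
  case 0 show ?case by simp
next
  case (Suc n) then show ?case using char4_times[OF assms Suc] by simp
qed

lemma char4_pow4: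
  assumes "char4 d w" shows "w k ^ 4 \<simeq> 1"
proof -
  have "w k ^ 4 = (w k * w k) * (w k * w k)" by (simp add: eval_nat_numeral)
  moreover have "(w k * w k) * (w k * w k) \<simeq> w (bmult d k k) * w (bmult d k k)"
    by (intro cong_mult cong_sym[OF char4_mult] assms)
  moreover have "w (bmult d k k) * w (bmult d k k) \<simeq> w b0"
    using char4_mult[OF assms, of "bmult d k k" "bmult d k k"] by (simp add: bmult_4 cong_sym)
  ultimately show ?thesis using char4_b0[OF assms] by (metis cong_trans)
qed

lemma char4_not_0: "char4 d w \<Longrightarrow> \<not> w k \<simeq> 0"
proof
  assume "char4 d w" "w k \<simeq> 0"
  then have "1 \<simeq> 0 ^ 4" using char4_pow4 by (metis cong_pow cong_sym cong_trans)
  then show False using not_1_0 by simp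
qed

lemma group_twist:
  assumes "char4 d w" "char4 d \<alpha>"
  shows "group (twist d w \<alpha>)"
proof (rule groupI, goal_cases)
  case (1 a b)
  then show ?case by (elim pt_cases) (simp add: pt_mult)
next
  case 2
  then show ?case by (simp add: one_twist)
next
  case (3 a b c)
  then obtain x k y m z n where [simp]: "a = pt x k" "b = pt y m" "c = pt z n" by (elim pt_cases)
  show ?case
    by (simp add: pt_mult, intro pt_eqI bmult_assoc,
      rule cong_linear2[OF char4_mult[OF assms(1), of m n] char4_mult[OF assms(2), of k m], of _ _ "- x" z])
      (simp add: algebra_simps)
next
  case (4 a)
  then obtain x k where [simp]: "a = pt x k" by (elim pt_cases)
  show ?case
    by (simp add: one_twist pt_mult, intro pt_eqI,
       rule cong_linear1[OF char4_b0[OF assms(2)], of _ _ x]) (simp_all add: algebra_simps)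
next
  case (5 a)
  then obtain x k where [simp]: "a = pt x k" by (elim pt_cases)
  \<comment> \<open>Both cubes are inverses: \<open>?j\<close> is the inverse of \<open>k\<close>,
    and \<open>w k ^ 3\<close> undoes the factor \<open>w k\<close> that multiplies the first
    component of the left factor.\<close>
  let ?j = "bmult d k (bmult d k k)"
  have "pt (- (\<alpha> ?j * x) * w k ^ 3) ?j \<otimes>\<^bsub>twist d w \<alpha>\<^esub> a = pt 0 b0"
    by (simp add: pt_mult, intro pt_eqI,
       rule cong_linear1[OF char4_pow4[OF assms(1), of k], of _ _ "- (\<alpha> ?j * x)"])
      (simp_all add: algebra_simps eval_nat_numeral bmult_comm bmult_inverse)
  then show ?case by (metis one_twist pt_carrier)
qed

text \<open>Describes the Sylow q-subgroup by an equation in the group, which every isomorphism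
  preserves. The second component of a q-th power is unchanged since \<open>q\<close> is 1 modulo
  4.\<close>

lemma split4_pow_eq_1_iff:
  assumes "char4 c \<chi>" "a \<in> carrier (split4 c \<chi>)"
  shows "a [^]\<^bsub>split4 c \<chi>\<^esub> q = \<one>\<^bsub>split4 c \<chi>\<^esub> \<longleftrightarrow> snd a = b0"
proof -
  interpret group "split4 c \<chi>" by (rule group_twist) (use assms in auto)
  obtain x k where a: "a = pt x k" using assms(2) by (elim pt_cases)
  have "snd (a [^]\<^bsub>split4 c \<chi>\<^esub> n) = k [^]\<^bsub>ext4 c\<^esub> n" for n :: nat
  proof (induction n)
    case 0 show ?case by (simp add: one_twist)
  next
    case (Suc n)
    obtain y m where y: "a [^]\<^bsub>split4 c \<chi>\<^esub> n = pt y m"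
      by (rule pt_cases[OF nat_pow_closed[OF assms(2)]])
    then show ?case using Suc a by (simp add: pt_mult)
  qed
  then have s: "snd (a [^]\<^bsub>split4 c \<chi>\<^esub> q) = k" by (simp add: ext4_pow q_mod_4)
  have p: "pt x b0 [^]\<^bsub>split4 c \<chi>\<^esub> n = pt (int n * x) b0" for n :: nat
  proof (induction n)
    case 0 show ?case by (simp add: one_twist)
  next
    case (Suc n)
    show ?case by (simp add: Suc pt_mult, intro pt_eqI refl,
       rule cong_linear1[OF char4_b0[OF assms(1)], of _ _ x]) (simp add: algebra_simps)
  qed
  show ?thesis
  proof
    assume "a [^]\<^bsub>split4 c \<chi>\<^esub> q = \<one>\<^bsub>split4 c \<chi>\<^esub>"
    then show "snd a = b0" using s a by (metis one_twist snd_pt)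
  next
    assume "snd a = b0"
    then show "a [^]\<^bsub>split4 c \<chi>\<^esub> q = \<one>\<^bsub>split4 c \<chi>\<^esub>"
      using p[of q] a by (simp add: one_twist pt_eq_iff cong_0_iff)
  qed
qed

text \<open>An isomorphism preserves the solutions of \<open>a ^ q = 1\<close>, hence acts on Z_q as
  multiplication by a unit \<open>a\<close>; splitting \<open>pt x k\<close> into
  \<open>pt x b0\<close> and \<open>pt 0 k\<close> gives the rest. The map \<open>t\<close> measures
  how far the complement is moved. The form serves for the \<lambda>-maps of a brace, for brace
  isomorphisms and for telling the five groups apart.\<close>

lemma iso_split4_form:
  assumes chi: "char4 c \<chi>" and chi': "char4 c' \<chi>'" and f: "f \<in> iso (split4 c \<chi>) (split4 c' \<chi>')"
  obtains a t \<theta> where "\<And>x k. f (pt x k) = pt (a * x + t k) (\<theta> k)" "\<not> a \<simeq> 0" "bij \<theta>"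
    "\<And>k m. \<theta> (bmult c k m) = bmult c' (\<theta> k) (\<theta> m)" "\<And>k. \<chi>' (\<theta> k) \<simeq> \<chi> k"
    "\<And>k m. t (bmult c k m) \<simeq> t k + \<chi> k * t m"
proof -
  let ?G = "split4 c \<chi>" and ?H = "split4 c' \<chi>'"
  interpret G: group ?G by (rule group_twist) (use chi in auto)
  interpret H: group ?H by (rule group_twist) (use chi' in auto)
  have hom: "f \<in> hom ?G ?H" and bij: "bij_betw f (carrier ?G) (carrier ?H)" using f by (auto simp: iso_def)
  have fm: "f (a \<otimes>\<^bsub>?G\<^esub> b) = f a \<otimes>\<^bsub>?H\<^esub> f b" if "a \<in> carrier ?G" "b \<in> carrier ?G" for a b
    using hom that by (simp add: hom_mult)
  have fc: "f a \<in> carrier ?H" if "a \<in> carrier ?G" for a using hom that by (auto simp: hom_def)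
  have P: "snd (f (pt x b0)) = b0" for x
  proof -
    have "pt x b0 [^]\<^bsub>?G\<^esub> q = \<one>\<^bsub>?G\<^esub>" using split4_pow_eq_1_iff[OF chi pt_carrier] by simp
    then have "f (pt x b0) [^]\<^bsub>?H\<^esub> q = \<one>\<^bsub>?H\<^esub>"
      using hom_nat_pow[OF hom pt_carrier G.group_axioms H.group_axioms, of x b0 q]
        hom_one[OF hom G.group_axioms H.group_axioms] by simp
    then show ?thesis using split4_pow_eq_1_iff[OF chi' fc[OF pt_carrier]] by simp
  qed
  define a t \<theta> where "a = fst (f (pt 1 b0))" and "t k = fst (f (pt 0 k))" and "\<theta> k = snd (f (pt 0 k))" for k
  have f1: "f (pt 1 b0) = pt a b0"
    using P[of 1] pt_collapse fc[OF pt_carrier] by (metis a_def carrier_twist)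
  have f0: "f (pt 0 k) = pt (t k) (\<theta> k)" for k
    using pt_collapse fc[OF pt_carrier] by (metis t_def \<theta>_def carrier_twist)
  have fn: "f (pt (int n) b0) = pt (a * int n) b0" for n
  proof (induction n)
    case 0 show ?case using hom_one[OF hom G.group_axioms H.group_axioms] by (simp add: one_twist)
  next
    case (Suc n)
    have "pt (int (Suc n)) b0 = pt (int n) b0 \<otimes>\<^bsub>?G\<^esub> pt 1 b0"
      by (simp add: pt_mult, intro pt_eqI refl, rule cong_linear1[OF char4_b0[OF chi], of _ _ "-1"]) simp
    then have "f (pt (int (Suc n)) b0) = pt (a * int n) b0 \<otimes>\<^bsub>?H\<^esub> pt a b0"
      using fm[OF pt_carrier pt_carrier] Suc f1 by simp
    also have "\<dots> = pt (a * int (Suc n)) b0"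
      by (simp add: pt_mult, intro pt_eqI refl, rule cong_linear1[OF char4_b0[OF chi'], of _ _ "a"])
        (simp add: algebra_simps)
    finally show ?case .
  qed
  have fP: "f (pt x b0) = pt (a * x) b0" for x
  proof -
    have e: "int (nat (x mod int q)) \<simeq> x" using q_ge by simp
    then have "pt x b0 = pt (int (nat (x mod int q))) b0" by (intro pt_eqI refl) (rule cong_sym)
    then have "f (pt x b0) = pt (a * int (nat (x mod int q))) b0" by (simp only: fn)
    also have "\<dots> = pt (a * x) b0" by (intro pt_eqI refl cong_mult cong_refl e)
    finally show ?thesis .
  qed
  have form: "f (pt x k) = pt (a * x + t k) (\<theta> k)" for x k
  proof -
    have "pt x k = pt x b0 \<otimes>\<^bsub>?G\<^esub> pt 0 k" by (simp add: pt_mult)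
    then have "f (pt x k) = pt (a * x) b0 \<otimes>\<^bsub>?H\<^esub> pt (t k) (\<theta> k)"
      using fm[OF pt_carrier pt_carrier] fP f0 by simp
    also have "\<dots> = pt (a * x + t k) (\<theta> k)"
      by (simp add: pt_mult, intro pt_eqI refl, rule cong_linear1[OF char4_b0[OF chi'], of _ _ "t k"])
        (simp add: algebra_simps)
    finally show ?thesis .
  qed
  have a0: "\<not> a \<simeq> 0"
  proof
    assume "a \<simeq> 0"
    then have "f (pt 1 b0) = f (pt 0 b0)" using fP[of 0] f1 by (simp add: pt_eq_iff)
    then have "pt 1 b0 = pt 0 b0" using bij by (meson bij_betw_imp_inj_on inj_onD pt_carrier)
    then show False using not_1_0 by (simp add: pt_eq_iff)
  qed
  have "surj \<theta>"
  proof -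
    have "\<exists>k. \<theta> k = m" for m
    proof -
      have "pt 0 m \<in> f ` carrier ?G" using bij by (simp add: bij_betw_def)
      then obtain b where "b \<in> carrier ?G" "pt 0 m = f b" by blast
      moreover from this obtain x k where "b = pt x k" by (elim pt_cases)
      ultimately show ?thesis using form by (metis snd_pt)
    qed
    then show ?thesis by (metis surjI)
  qed
  then have bij\<theta>: "bij \<theta>" by (simp add: bij_def finite_UNIV_surj_inj)
  have "pt (a * (\<chi> k * 0) + t (bmult c k m)) (\<theta> (bmult c k m)) =
      pt (t k + \<chi>' (\<theta> k) * t m) (bmult c' (\<theta> k) (\<theta> m))" for k m
    using fm[of "pt 0 k" "pt 0 m"] by (simp add: pt_mult f0)
  then have th_mult: "\<theta> (bmult c k m) = bmult c' (\<theta> k) (\<theta> m)"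
    and tm: "t (bmult c k m) \<simeq> t k + \<chi>' (\<theta> k) * t m" for k m
    by (auto simp: pt_eq_iff)
  have chi_th: "\<chi>' (\<theta> k) \<simeq> \<chi> k" for k
  proof -
    \<comment> \<open>Evaluating the image of the product of \<open>pt 0 k\<close> and
      \<open>pt 1 b0\<close> in two ways compares the two actions on Z_q.\<close>
    have "a * \<chi> k + t k \<simeq> t k + \<chi>' (\<theta> k) * a"
      using fm[OF pt_carrier pt_carrier, of 0 k 1 b0] unfolding fP f0 by (simp add: pt_mult form pt_eq_iff)
    then have "a * \<chi>' (\<theta> k) \<simeq> a * \<chi> k"
      by (rule cong_linear1[where c = "-1"]) (simp add: algebra_simps)
    then show ?thesis using cong_cancel[OF a0] by blast
  qed
  have "t (bmult c k m) \<simeq> t k + \<chi> k * t m" for k m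
    by (rule cong_linear2[OF tm[of k m] chi_th[of k], of _ _ 1 "t m"]) (simp add: algebra_simps)
  then show ?thesis by (rule that[OF form a0 bij\<theta> th_mult chi_th])
qed

end

section \<open>Braces over a split extension\<close>

text \<open>Additivity is the brace law with the additive inverse of \<open>a\<close> put in front;
  the inverse map comes from solving \<open>c = - a + a \<circ> b\<close> for
  \<open>b\<close>.\<close>

lemma (in skew_brace) lambda_iso:
  assumes a: "a \<in> carrier A"
  shows "(\<lambda>b. inv\<^bsub>A\<^esub> a \<otimes>\<^bsub>A\<^esub> (a \<otimes>\<^bsub>C\<^esub> b)) \<in> iso A A"
proof -
  let ?l = "\<lambda>b. inv\<^bsub>A\<^esub> a \<otimes>\<^bsub>A\<^esub> (a \<otimes>\<^bsub>C\<^esub> b)"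
  have c: "x \<otimes>\<^bsub>C\<^esub> y \<in> carrier A" if "x \<in> carrier A" "y \<in> carrier A" for x y
    using that circ.m_closed carrier_eq by simp
  have "?l \<in> hom A A"
    using a c by (intro homI) (simp_all add: brace add.m_assoc)
  moreover have "bij_betw ?l (carrier A) (carrier A)"
  proof (rule bij_betw_byWitness[where f' = "\<lambda>b. inv\<^bsub>C\<^esub> a \<otimes>\<^bsub>C\<^esub> (a \<otimes>\<^bsub>A\<^esub> b)"])
    have ic: "inv\<^bsub>C\<^esub> a \<in> carrier A" using a circ.inv_closed carrier_eq by simp
    have l: "inv\<^bsub>C\<^esub> a \<otimes>\<^bsub>C\<^esub> (a \<otimes>\<^bsub>C\<^esub> b) = b" "a \<otimes>\<^bsub>C\<^esub> (inv\<^bsub>C\<^esub> a \<otimes>\<^bsub>C\<^esub> b) = b" if "b \<in> carrier A" for b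
      using a that circ.m_assoc[symmetric] ic by (simp_all add: carrier_eq)
    show "\<forall>b\<in>carrier A. inv\<^bsub>C\<^esub> a \<otimes>\<^bsub>C\<^esub> (a \<otimes>\<^bsub>A\<^esub> ?l b) = b"
      using a c l by (simp add: add.m_assoc[symmetric])
    show "\<forall>b\<in>carrier A. ?l (inv\<^bsub>C\<^esub> a \<otimes>\<^bsub>C\<^esub> (a \<otimes>\<^bsub>A\<^esub> b)) = b"
      using a c l by (simp add: add.m_assoc[symmetric])
  qed (use a c circ.inv_closed carrier_eq in auto)
  ultimately show ?thesis by (simp add: iso_def)
qed

text \<open>For Z_4 the nontrivial shear is inversion, for Z_2^2 it is the transvection that fixes
  \<open>(False, True)\<close>.\<close>

definition shear :: "bool \<Rightarrow> bits \<Rightarrow> bits" where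
  "shear z k = (fst k, snd k \<noteq> (fst k \<and> z))"

lemma shear_False [simp]: "shear False k = k" and shear_b0 [simp]: "shear z b0 = b0"
  by (simp_all add: shear_def)

lemma shear_shear: "shear y (shear z k) = shear (y \<noteq> z) k"
  by (auto simp: shear_def)

lemma shear_inject: "shear y (True, False) = shear z (True, False) \<Longrightarrow> y = z"
  by (simp add: shear_def)

lemma bij_shear: "bij (shear z)"
  by (rule involuntory_imp_bij) (simp add: shear_shear)

lemma shear_bmult: "shear z (bmult c k m) = bmult c (shear z k) (shear z m)"
  by (auto simp: shear_def bmult_def)

text \<open>The kernel of the first bit has a single nonzero element, which must be fixed; only the
  second bit of the image of \<open>(True, False)\<close> is free.\<close>

lemma hom_eq_shear:
  assumes "bij \<theta>" "\<And>k m. \<theta> (bmult c k m) = bmult c (\<theta> k) (\<theta> m)" "\<And>k. fst (\<theta> k) = fst k"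
  obtains z where "\<And>k. \<theta> k = shear z k"
proof -
  define z where "z = snd (\<theta> (True, False))"
  have 0: "\<theta> b0 = b0" using assms(2)[of b0 b0] by (metis bmult_cancel bmult_b0(1,2))
  have "\<theta> (False, True) \<noteq> b0"
    using assms(1) 0 by (metis bij_pointE prod.inject)
  then have 1: "\<theta> (False, True) = (False, True)"
    using assms(3)[of "(False, True)"] by (cases "\<theta> (False, True)") auto
  have 2: "\<theta> (True, False) = (True, z)"
    using assms(3)[of "(True, False)"] by (simp add: z_def prod_eq_iff)
  have "\<theta> (True, True) = bmult c (\<theta> (True, False)) (\<theta> (False, True))"
    using assms(2)[of "(True, False)" "(False, True)"] by (simp add: bmult_def)
  then have 3: "\<theta> (True, True) = (True, \<not> z)" using 1 2 by (simp add: bmult_def)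
  have "\<forall>k. \<theta> k = shear z k" unfolding bits_exhaust using 0 1 2 3 by (simp add: shear_def)
  then show ?thesis using that by blast
qed

text \<open>This is the brace structure on K. If \<open>z (False, True)\<close> held, the twisted
  product of \<open>(False, True)\<close> and \<open>(True, False)\<close> would be
  \<open>(True, False)\<close> again, whereas its bit \<open>z\<close> would have flipped; so
  \<open>z\<close> depends on the first bit only. A shear by that bit adds the conjunction of the
  first bits to the result, which toggles the carry and thus exchanges Z_4 and Z_2^2.\<close>

lemma twisted_bmult:
  assumes "\<And>k m. z (bmult c k (shear (z k) m)) = (z k \<noteq> z m)"
  obtains l where "\<And>k. z k = (fst k \<and> l)" "\<And>k m. bmult c k (shear (z k) m) = bmult (c \<noteq> l) k m"
proof -
  define l where "l = z (True, False)"
  have 0: "\<not> z b0" using assms[of b0 b0] by simp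
  have "\<not> z (False, True)"
    using assms[of "(False, True)" "(True, False)"] assms[of "(True, False)" "(False, True)"] 0
    by (cases "z (True, True)"; cases l; auto simp: bmult_def shear_def l_def)
  moreover from this have "z (True, True) = l"
    using assms[of "(False, True)" "(True, False)"] by (simp add: bmult_def shear_def l_def)
  ultimately have "\<forall>k. z k = (fst k \<and> l)" unfolding bits_exhaust using 0 by (simp add: l_def)
  then have z: "z k = (fst k \<and> l)" for k by blast
  have "bmult c k (shear (z k) m) = bmult (c \<noteq> l) k m" for k m
    unfolding z by (auto simp: bmult_def shear_def)
  then show ?thesis using that z by blast
qed

context prime_1_mod_4
begin

text \<open>The scalar \<open>p\<close> may vary with \<open>k\<close>, since untwisting rescales
  every coset of Z_q by its own factor. Surjectivity comes from counting.\<close>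

lemma affine_iso:
  assumes "bij \<theta>" and p: "\<And>k. \<not> p k \<simeq> 0"
    and car: "carrier G = {0..<int q} \<times> UNIV" "carrier H = {0..<int q} \<times> UNIV"
    and F: "\<And>x k. F (pt x k) = pt (p k * x + t k) (\<theta> k)"
    and hom: "\<And>x k y m. F (pt x k \<otimes>\<^bsub>G\<^esub> pt y m) = F (pt x k) \<otimes>\<^bsub>H\<^esub> F (pt y m)"
  shows "F \<in> iso G H"
proof -
  have ex: "\<exists>x k. a = pt x k" if "a \<in> {0..<int q} \<times> UNIV" for a
    using pt_collapse[OF that] by metis
  have c: "pt x k \<in> {0..<int q} \<times> UNIV" for x k using pt_carrier by (simp add: carrier_twist)
  have "F \<in> hom G H"
  proof (rule homI)
    fix a b assume ab: "a \<in> carrier G" "b \<in> carrier G"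
    then obtain x k y m where e: "a = pt x k" "b = pt y m" using ex[of a] ex[of b] car by blast
    show "F a \<in> carrier H" unfolding e F car by (rule c)
    show "F (a \<otimes>\<^bsub>G\<^esub> b) = F a \<otimes>\<^bsub>H\<^esub> F b" unfolding e by (rule hom)
  qed
  moreover have inj: "inj_on F ({0..<int q} \<times> UNIV)"
  proof (rule inj_onI)
    fix a b assume "a \<in> {0..<int q} \<times> UNIV" "b \<in> {0..<int q} \<times> UNIV" and e: "F a = F b"
    then obtain x k y m where ab: "a = pt x k" "b = pt y m" using ex by meson
    have "\<theta> k = \<theta> m" using e by (simp add: ab F pt_eq_iff)
    then have k: "k = m" using assms(1) by (metis bij_pointE)
    then have "p k * x + t k \<simeq> p k * y + t k" using e by (simp add: ab F pt_eq_iff)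
    then have "x \<simeq> y" using cong_add_rcancel cong_cancel[OF p] by blast
    then show "a = b" by (simp add: ab k pt_eq_iff)
  qed
  moreover have "F ` ({0..<int q} \<times> UNIV) = {0..<int q} \<times> UNIV"
  proof (rule card_subset_eq)
    show "F ` ({0..<int q} \<times> UNIV) \<subseteq> {0..<int q} \<times> UNIV" using ex F c by (metis image_subsetI)
    show "card (F ` ({0..<int q} \<times> UNIV)) = card ({0..<int q} \<times> (UNIV :: bits set))"
      by (rule card_image[OF inj])
  qed simp
  ultimately show ?thesis by (simp add: iso_def bij_betw_def car)
qed

lemma cocycle_trivial:
  assumes "char4 d \<alpha>" "char4 d v"
    and g: "\<And>k m. \<gamma> (bmult d k m) \<simeq> \<alpha> k * \<gamma> m + v m * \<gamma> k"
  obtains s where "\<And>k. \<gamma> k \<simeq> s * (v k - \<alpha> k)"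
  \<comment> \<open>Exchanging \<open>k\<close> and \<open>m\<close> in the cocycle identity takes the place of averaging over the group.\<close>
proof (cases "\<exists>m. \<not> v m - \<alpha> m \<simeq> 0")
  case True
  then obtain m i where i: "(v m - \<alpha> m) * i \<simeq> 1" using cong_inverse by metis
  have "\<gamma> k \<simeq> \<gamma> m * i * (v k - \<alpha> k)" for k
  proof -
    have e: "\<alpha> k * \<gamma> m + v m * \<gamma> k \<simeq> \<alpha> m * \<gamma> k + v k * \<gamma> m"
      using g[of k m] g[of m k] bmult_comm[of d k m] by (metis cong_sym cong_trans)
    show ?thesis
      by (rule cong_linear2[OF i e, of _ _ "- \<gamma> k" i]) (simp add: algebra_simps)
  qed
  then show ?thesis using that by blast
next
  case False
  then have va: "v k \<simeq> \<alpha> k" for k using cong_diff_iff_cong_0 by blast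
  \<comment> \<open>Now the claim is \<open>\<gamma> k \<simeq> 0\<close>. Doubling \<open>k\<close>
    multiplies \<gamma> by a unit, as \<open>q\<close> is odd, and doubling twice leads to
    \<open>b0\<close>.\<close>
  have dbl: "\<gamma> (bmult d k k) \<simeq> (2 * \<alpha> k) * \<gamma> k" for k
    by (rule cong_linear2[OF g[of k k] va[of k], of _ _ 1 "\<gamma> k"]) (simp add: algebra_simps)
  have cancel: "\<gamma> k \<simeq> 0" if "\<gamma> (bmult d k k) \<simeq> 0" for k
  proof -
    have "(2 * \<alpha> k) * \<gamma> k \<simeq> 0" using dbl[of k] that by (metis cong_sym cong_trans)
    then show ?thesis using not_2_0 char4_not_0[OF assms(1)] by (simp add: cong_mult_0)
  qed
  have "\<gamma> b0 \<simeq> 0"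
    by (rule cong_linear2[OF dbl[of b0] char4_b0[OF assms(1)], of _ _ "-1" "-2 * \<gamma> b0"])
      (simp add: algebra_simps)
  then have "\<gamma> k \<simeq> 0" for k using cancel bmult_4 by metis
  moreover have "\<gamma> k \<simeq> 0 \<Longrightarrow> \<gamma> k \<simeq> 0 * (v k - \<alpha> k)" for k by simp
  ultimately show ?thesis using that by blast
qed

text \<open>The product is \<open>a\<close> plus the \<lambda>-map of \<open>a\<close>, an
  automorphism of known form. Since \<chi> separates the first bits, its action on K is a shear;
  since \<chi> is nontrivial, its cocycle \<open>t\<close> is a multiple of
  \<open>1 - \<chi> m\<close>, as exchanging \<open>m\<close> and \<open>k1\<close> shows.\<close>

lemma skew_brace_translation_form:
  assumes chi: "char4 c \<chi>" and nt: "\<not> \<chi> k1 \<simeq> 1"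
    and sep: "\<And>k m. \<chi> k \<simeq> \<chi> m \<Longrightarrow> fst k = fst m"
    and B: "skew_brace (split4 c \<chi>) C" and a: "a \<in> carrier (split4 c \<chi>)"
  obtains A G z where "\<not> A \<simeq> 0" "\<And>m. \<chi> (shear z m) \<simeq> \<chi> m"
    "\<And>y m. a \<otimes>\<^bsub>C\<^esub> pt y m = pt (A * y + fst a + G * (\<chi> m - 1)) (bmult c (snd a) (shear z m))"
proof -
  let ?X = "split4 c \<chi>"
  interpret skew_brace ?X C by fact
  let ?l = "\<lambda>b. inv\<^bsub>?X\<^esub> a \<otimes>\<^bsub>?X\<^esub> (a \<otimes>\<^bsub>C\<^esub> b)"
  obtain A t \<theta> where l: "\<And>x k. ?l (pt x k) = pt (A * x + t k) (\<theta> k)" and A: "\<not> A \<simeq> 0"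
    and th: "bij \<theta>" "\<And>k m. \<theta> (bmult c k m) = bmult c (\<theta> k) (\<theta> m)" and ct: "\<And>k. \<chi> (\<theta> k) \<simeq> \<chi> k"
    and t: "\<And>k m. t (bmult c k m) \<simeq> t k + \<chi> k * t m"
  proof (rule iso_split4_form[OF chi chi lambda_iso[OF a]], goal_cases)
    case (1 A t \<theta>)
    then show ?case by (intro 1(1))
  qed
  obtain z where z: "\<And>k. \<theta> k = shear z k" using hom_eq_shear[OF th sep[OF ct]] by blast
  obtain i where i: "(1 - \<chi> k1) * i \<simeq> 1"
    using nt cong_inverse[of "1 - \<chi> k1"] by (metis cong_diff_iff_cong_0 cong_sym)
  have t': "t m \<simeq> t k1 * i * (1 - \<chi> m)" for m
  proof -
    have e: "t m + \<chi> m * t k1 \<simeq> t k1 + \<chi> k1 * t m"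
      using t[of k1 m] t[of m k1] bmult_comm[of c m k1] by (metis cong_sym cong_trans)
    show ?thesis
      by (rule cong_linear2[OF i e, of _ _ "- t m" i]) (simp add: algebra_simps)
  qed
  obtain x k where ak: "a = pt x k" using a by (elim pt_cases)
  have xa: "fst a \<simeq> x" by (simp add: ak fst_pt)
  have "a \<otimes>\<^bsub>C\<^esub> pt y m = pt (\<chi> k * A * y + fst a + (- \<chi> k * t k1 * i) * (\<chi> m - 1)) (bmult c (snd a) (shear z m))"
    for y m
  proof -
    have "a \<otimes>\<^bsub>C\<^esub> pt y m \<in> carrier ?X"
      using a circ.m_closed carrier_eq pt_carrier by metis
    then have "a \<otimes>\<^bsub>C\<^esub> pt y m = a \<otimes>\<^bsub>?X\<^esub> ?l (pt y m)"
      using a by (simp add: add.m_assoc[symmetric])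
    also have "\<dots> = pt (x + \<chi> k * (A * y + t m)) (bmult c k (\<theta> m))"
      unfolding l unfolding ak by (simp add: pt_mult)
    also have "\<dots> = pt (\<chi> k * A * y + fst a + (- \<chi> k * t k1 * i) * (\<chi> m - 1)) (bmult c (snd a) (shear z m))"
      by (rule pt_eqI, rule cong_linear2[OF t'[of m] xa, of _ _ "\<chi> k" "-1"])
        (simp_all add: ak z algebra_simps)
    finally show ?thesis .
  qed
  moreover have "\<not> \<chi> k * A \<simeq> 0" using char4_not_0[OF chi] A by (simp add: cong_mult_0)
  moreover have "\<chi> (shear z m) \<simeq> \<chi> m" for m using ct[of m] by (simp add: z)
  ultimately show ?thesis using that by blast
qed

end

section \<open>Normal form of the multiplicative group\<close>

context prime_1_mod_4
begin

text \<open>The isomorphism of \<open>C\<close> with a split extension supplies the normality of the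
  Sylow q-subgroup. The last conclusion records that the carry can change only through a shear,
  which \<chi> then has to tolerate.\<close>

theorem skew_brace_structure:
  assumes chi: "char4 c \<chi>" and nt: "\<not> \<chi> k1 \<simeq> 1"
    and sep: "\<And>k m. \<chi> k \<simeq> \<chi> m \<Longrightarrow> fst k = fst m"
    and B: "skew_brace (split4 c \<chi>) C" and psi: "char4 d0 \<psi>" and Y: "C \<cong> split4 d0 \<psi>"
  obtains d e \<alpha> f where "char4 d \<chi>" "char4 d \<alpha>" "f \<in> iso (split4 c \<chi>) (split4 c \<chi>)"
    "f \<in> iso C (twist d (if e then \<chi> else (\<lambda>_. 1)) \<alpha>)"
    "d \<noteq> c \<Longrightarrow> \<chi> (True, True) \<simeq> \<chi> (True, False)"
proof -
  let ?X = "split4 c \<chi>"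
  interpret skew_brace ?X C by fact
  have cC: "carrier C = carrier ?X" by (rule carrier_eq)
  have "\<forall>a\<in>carrier ?X. \<exists>A G z. \<not> A \<simeq> 0 \<and> (\<forall>m. \<chi> (shear z m) \<simeq> \<chi> m) \<and>
     (\<forall>y m. a \<otimes>\<^bsub>C\<^esub> pt y m = pt (A * y + fst a + G * (\<chi> m - 1)) (bmult c (snd a) (shear z m)))"
  proof
    fix a assume "a \<in> carrier ?X"
    from skew_brace_translation_form[OF chi nt sep B this]
    show "\<exists>A G z. \<not> A \<simeq> 0 \<and> (\<forall>m. \<chi> (shear z m) \<simeq> \<chi> m) \<and>
     (\<forall>y m. a \<otimes>\<^bsub>C\<^esub> pt y m = pt (A * y + fst a + G * (\<chi> m - 1)) (bmult c (snd a) (shear z m)))"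
      by (metis (no_types, lifting))
  qed
  then obtain A G Z where AGZ: "\<And>a. a \<in> carrier ?X \<Longrightarrow> \<not> A a \<simeq> 0 \<and> (\<forall>m. \<chi> (shear (Z a) m) \<simeq> \<chi> m) \<and>
     (\<forall>y m. a \<otimes>\<^bsub>C\<^esub> pt y m = pt (A a * y + fst a + G a * (\<chi> m - 1)) (bmult c (snd a) (shear (Z a) m)))"
    by metis
  have A0: "\<not> A a \<simeq> 0" if "a \<in> carrier ?X" for a using AGZ[OF that] by blast
  have chi_sh: "\<chi> (shear (Z a) m) \<simeq> \<chi> m" if "a \<in> carrier ?X" for a m using AGZ[OF that] by blast
  have L: "a \<otimes>\<^bsub>C\<^esub> pt y m = pt (A a * y + fst a + G a * (\<chi> m - 1)) (bmult c (snd a) (shear (Z a) m))"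
    if "a \<in> carrier ?X" for a y m using AGZ[OF that] by blast
  have nt0: "\<not> \<chi> k1 - 1 \<simeq> 0" using nt cong_diff_iff_cong_0 by blast
  have chi0: "\<chi> b0 \<simeq> 1" by (rule char4_b0[OF chi])
  have closed: "a \<otimes>\<^bsub>C\<^esub> b \<in> carrier ?X" if "a \<in> carrier ?X" "b \<in> carrier ?X" for a b
    using that circ.m_closed cC by simp

  \<comment> \<open>Associativity applied to \<open>a\<close>, \<open>b\<close> and
    \<open>pt y m\<close>, parameter by parameter: subtracting \<open>y = 0\<close> from
    \<open>y = 1\<close> isolates \<open>A\<close>, evaluating at \<open>k1\<close> and dividing by
    \<open>\<chi> k1 - 1\<close> gives \<open>G\<close>, and \<open>(True, False)\<close>, which a
    nontrivial shear moves, gives \<open>Z\<close>.\<close>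
  have laws: "snd (a \<otimes>\<^bsub>C\<^esub> b) = bmult c (snd a) (shear (Z a) (snd b))"
      "fst (a \<otimes>\<^bsub>C\<^esub> b) \<simeq> A a * fst b + fst a + G a * (\<chi> (snd b) - 1)"
      "A (a \<otimes>\<^bsub>C\<^esub> b) \<simeq> A a * A b"
      "G (a \<otimes>\<^bsub>C\<^esub> b) \<simeq> A a * G b + \<chi> (snd b) * G a"
      "Z (a \<otimes>\<^bsub>C\<^esub> b) = (Z a \<noteq> Z b)"
    if a: "a \<in> carrier ?X" and b: "b \<in> carrier ?X" for a b
  proof -
    let ?ab = "a \<otimes>\<^bsub>C\<^esub> b"
    have bp: "b = pt (fst b) (snd b)" using pt_collapse b by (simp add: carrier_twist)
    have ab: "?ab = pt (A a * fst b + fst a + G a * (\<chi> (snd b) - 1)) (bmult c (snd a) (shear (Z a) (snd b)))"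
      using L[OF a, of "fst b" "snd b"] bp by simp
    show s: "snd ?ab = bmult c (snd a) (shear (Z a) (snd b))" by (simp add: ab)
    show f: "fst ?ab \<simeq> A a * fst b + fst a + G a * (\<chi> (snd b) - 1)" unfolding ab by (rule fst_pt)
    have "pt (A ?ab * y + fst ?ab + G ?ab * (\<chi> m - 1)) (bmult c (snd ?ab) (shear (Z ?ab) m)) =
       pt (A a * (A b * y + fst b + G b * (\<chi> m - 1)) + fst a + G a * (\<chi> (bmult c (snd b) (shear (Z b) m)) - 1))
         (bmult c (snd a) (shear (Z a) (bmult c (snd b) (shear (Z b) m))))" for y m
      using circ.m_assoc[of a b "pt y m"] a b cC by (simp add: L closed)
    then have E: "A ?ab * y + fst ?ab + G ?ab * (\<chi> m - 1) \<simeq>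
        A a * (A b * y + fst b + G b * (\<chi> m - 1)) + fst a + G a * (\<chi> (bmult c (snd b) (shear (Z b) m)) - 1)"
      and S: "bmult c (snd ?ab) (shear (Z ?ab) m) =
        bmult c (snd a) (shear (Z a) (bmult c (snd b) (shear (Z b) m)))" for y m
      unfolding pt_eq_iff by blast+
    have cm: "\<chi> (bmult c (snd b) (shear (Z b) m)) \<simeq> \<chi> (snd b) * \<chi> m" for m
      using char4_mult[OF chi] cong_scalar_left[OF chi_sh[OF b]] cong_trans by blast
    show AA: "A ?ab \<simeq> A a * A b"
    proof -
      have "A ?ab * 1 + fst ?ab + G ?ab * (\<chi> b0 - 1) - (A ?ab * 0 + fst ?ab + G ?ab * (\<chi> b0 - 1)) \<simeq>
        A a * (A b * 1 + fst b + G b * (\<chi> b0 - 1)) + fst a + G a * (\<chi> (bmult c (snd b) (shear (Z b) b0)) - 1) -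
        (A a * (A b * 0 + fst b + G b * (\<chi> b0 - 1)) + fst a + G a * (\<chi> (bmult c (snd b) (shear (Z b) b0)) - 1))"
        by (intro cong_diff E)
      then show ?thesis by (simp add: algebra_simps)
    qed
    have "(\<chi> k1 - 1) * G ?ab \<simeq> (\<chi> k1 - 1) * (A a * G b + \<chi> (snd b) * G a)"
      by (rule cong_linear3[OF E[of 0 k1] f cm[of k1], of _ _ 1 "-1" "G a"]) (simp add: algebra_simps)
    then show "G ?ab \<simeq> A a * G b + \<chi> (snd b) * G a" using cong_cancel[OF nt0] by blast
    show "Z ?ab = (Z a \<noteq> Z b)"
      using S[of "(True, False)"] unfolding s shear_bmult bmult_assoc bmult_cancel shear_shear
      by (rule shear_inject)
  qed

  have one: "\<one>\<^bsub>C\<^esub> = pt 0 b0"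
  proof -
    have oc: "\<one>\<^bsub>C\<^esub> \<in> carrier ?X" using circ.one_closed cC by simp
    have "pt 0 b0 = pt (fst \<one>\<^bsub>C\<^esub> + G \<one>\<^bsub>C\<^esub> * (\<chi> b0 - 1)) (snd \<one>\<^bsub>C\<^esub>)"
      using L[OF oc, of 0 b0] circ.l_one[of "pt 0 b0"] cC by simp
    also have "\<dots> = pt (fst \<one>\<^bsub>C\<^esub>) (snd \<one>\<^bsub>C\<^esub>)"
      by (rule pt_eqI[OF _ refl], rule cong_linear1[OF chi0, of _ _ "G \<one>\<^bsub>C\<^esub>"]) simp
    also have "\<dots> = \<one>\<^bsub>C\<^esub>" using pt_collapse oc by (simp add: carrier_twist)
    finally show ?thesis by simp
  qed
  have A1: "A \<one>\<^bsub>C\<^esub> \<simeq> 1"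
  proof -
    have "A \<one>\<^bsub>C\<^esub> * A \<one>\<^bsub>C\<^esub> \<simeq> A \<one>\<^bsub>C\<^esub> * 1"
      using laws(3)[of "\<one>\<^bsub>C\<^esub>" "\<one>\<^bsub>C\<^esub>"] one by (metis circ.l_one circ.one_closed cong_sym mult.right_neutral pt_carrier)
    then show ?thesis using cong_cancel[OF A0] one by (metis pt_carrier)
  qed
  have Z1: "\<not> Z \<one>\<^bsub>C\<^esub>" using laws(5)[of "\<one>\<^bsub>C\<^esub>" "\<one>\<^bsub>C\<^esub>"] one by (metis circ.l_one circ.one_closed pt_carrier)

  define P where "P = {a \<in> carrier ?X. snd a = b0}"
  \<comment> \<open>\<open>P\<close> is the Sylow \<open>q\<close>-subgroup of both groups; its normality in \<open>C\<close> is read off the isomorphism \<open>g\<close> below.\<close>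
  have P: "subgroup P C"
  proof (rule circ.subgroupI)
    show "P \<subseteq> carrier C" by (auto simp: P_def cC)
    have "pt 0 b0 \<in> P" by (simp add: P_def)
    then show "P \<noteq> {}" by blast
    show "a \<otimes>\<^bsub>C\<^esub> b \<in> P" if "a \<in> P" "b \<in> P" for a b
      using that laws(1)[of a b] closed by (simp add: P_def)
    show "inv\<^bsub>C\<^esub> a \<in> P" if "a \<in> P" for a
    proof -
      have ic: "inv\<^bsub>C\<^esub> a \<in> carrier ?X" "a \<in> carrier ?X" using that cC by (auto simp: P_def)
      have "snd (inv\<^bsub>C\<^esub> a \<otimes>\<^bsub>C\<^esub> a) = snd (inv\<^bsub>C\<^esub> a)"
        using laws(1)[OF ic] that by (simp add: P_def)
      moreover have "inv\<^bsub>C\<^esub> a \<otimes>\<^bsub>C\<^esub> a = pt 0 b0" using ic cC one by simp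
      ultimately show ?thesis using ic by (simp add: P_def)
    qed
  qed
  have P_eq: "P = {0..<int q} \<times> {b0}" by (auto simp: P_def carrier_twist)
  have card_P: "card P = q" by (simp add: P_eq card_cartesian_product)
  have Pq: "a [^]\<^bsub>C\<^esub> q = \<one>\<^bsub>C\<^esub>" if "a \<in> P" for a
  proof -
    interpret P: group "C\<lparr>carrier := P\<rparr>" by (rule circ.subgroup_imp_group[OF P])
    have "order (C\<lparr>carrier := P\<rparr>) = q" by (simp add: order_def card_P)
    then have "a [^]\<^bsub>C\<lparr>carrier := P\<rparr>\<^esub> q = \<one>\<^bsub>C\<^esub>" using P.pow_order_eq_1[of a] that by simp
    then show ?thesis using circ.nat_pow_consistent by metis
  qed
  \<comment> \<open>Elements of \<open>P\<close> have q-th power one. Hence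
    \<open>A a ^ q \<simeq> 1\<close>, which Fermat turns into \<open>A a \<simeq> 1\<close>, and
    \<open>Z a\<close> vanishes because \<open>q\<close> is odd.\<close>
  have PA: "A a \<simeq> 1" and PZ: "\<not> Z a" if "a \<in> P" for a
  proof -
    have ac: "a \<in> carrier ?X" using that by (simp add: P_def)
    have an: "a [^]\<^bsub>C\<^esub> n \<in> carrier ?X" for n :: nat using ac cC circ.nat_pow_closed by metis
    have "A (a [^]\<^bsub>C\<^esub> n) \<simeq> A a ^ n \<and> Z (a [^]\<^bsub>C\<^esub> n) = (odd n \<and> Z a)" for n :: nat
    proof (induction n)
      case 0 show ?case using A1 Z1 by simp
    next
      case (Suc n)
      have "A (a [^]\<^bsub>C\<^esub> n) * A a \<simeq> A a ^ n * A a" using Suc by (intro cong_scalar_right) blast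
      then show ?case using laws(3,5)[OF an[of n] ac] Suc by (auto simp: mult.commute intro: cong_trans)
    qed
    from this[of q] have "A a ^ q \<simeq> 1" "odd q \<Longrightarrow> \<not> Z a"
      using A1 Z1 unfolding Pq[OF that] by (auto intro: cong_trans cong_sym)
    moreover have "odd q" using q_mod_4 by presburger
    ultimately show "A a \<simeq> 1" "\<not> Z a" using cong_fermat cong_trans cong_sym by blast+
  qed

  obtain g where g: "g \<in> iso C (split4 d0 \<psi>)" using Y by (auto simp: is_iso_def)
  interpret Y: group "split4 d0 \<psi>" by (rule group_twist) (use psi in auto)
  have ghom: "g \<in> hom C (split4 d0 \<psi>)" and gbij: "bij_betw g (carrier ?X) (carrier ?X)"
    using g cC by (auto simp: iso_def carrier_twist)
  have snd_g: "snd (g (a \<otimes>\<^bsub>C\<^esub> b)) = bmult d0 (snd (g a)) (snd (g b))"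
    if "a \<in> carrier ?X" "b \<in> carrier ?X" for a b
  proof -
    have "g a \<in> carrier (split4 d0 \<psi>)" "g b \<in> carrier (split4 d0 \<psi>)"
      using gbij that by (auto simp: bij_betw_def carrier_twist)
    then obtain x k y m where "g a = pt x k" "g b = pt y m" by (elim pt_cases)
    then show ?thesis using hom_mult[OF ghom, of a b] that cC by (simp add: pt_mult)
  qed
  \<comment> \<open>The map \<open>g\<close> sends \<open>P\<close> into the elements killed by
    \<open>q\<close>, the fibre over \<open>b0\<close>; both sets have \<open>q\<close> elements, so
    they correspond exactly.\<close>
  have P_iff: "a \<in> P \<longleftrightarrow> snd (g a) = b0" if a: "a \<in> carrier ?X" for a
  proof -
    define P' where "P' = {a \<in> carrier ?X. snd (g a) = b0}"
    have "P \<subseteq> P'"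
    proof
      fix a assume aP: "a \<in> P"
      then have a: "a \<in> carrier C" by (simp add: P_def cC)
      have "g a [^]\<^bsub>split4 d0 \<psi>\<^esub> q = \<one>\<^bsub>split4 d0 \<psi>\<^esub>"
        using hom_nat_pow[OF ghom a circ.group_axioms Y.group_axioms, of q] Pq[OF aP]
          hom_one[OF ghom circ.group_axioms Y.group_axioms] by simp
      moreover have "g a \<in> carrier (split4 d0 \<psi>)" using ghom a by (auto simp: hom_def)
      ultimately show "a \<in> P'" using split4_pow_eq_1_iff[OF psi] aP by (simp add: P_def P'_def)
    qed
    moreover have "bij_betw g P' ({0..<int q} \<times> {b0})"
    proof (rule bij_betw_subset[OF gbij])
      show "P' \<subseteq> carrier ?X" by (auto simp: P'_def)
      have "{0..<int q} \<times> {b0} = {b \<in> g ` carrier ?X. snd b = b0}"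
        using gbij by (auto simp: bij_betw_def carrier_twist)
      then show "g ` P' = {0..<int q} \<times> {b0}" by (simp add: P'_def Collect_conj_eq) blast
    qed
    then have "card P' = q" using bij_betw_same_card by (fastforce simp: card_cartesian_product)
    moreover have "finite P'" unfolding P'_def carrier_twist by simp
    ultimately have "P = P'" using card_subset_eq card_P by metis
    then show ?thesis using a by (simp add: P'_def)
  qed
  have normal: "\<exists>a'\<in>P. a' \<otimes>\<^bsub>C\<^esub> b = b \<otimes>\<^bsub>C\<^esub> a" if b: "b \<in> carrier ?X" and a: "a \<in> P" for a b
  proof -
    let ?a' = "b \<otimes>\<^bsub>C\<^esub> a \<otimes>\<^bsub>C\<^esub> inv\<^bsub>C\<^esub> b"
    have ac: "a \<in> carrier ?X" using a by (simp add: P_def)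
    have a': "?a' \<in> carrier ?X" using b ac cC circ.inv_closed closed by metis
    have eq: "?a' \<otimes>\<^bsub>C\<^esub> b = b \<otimes>\<^bsub>C\<^esub> a" using b ac by (simp add: cC[symmetric] circ.m_assoc)
    have "bmult d0 (snd (g ?a')) (snd (g b)) = bmult d0 (snd (g b)) b0"
      using snd_g[OF a' b] snd_g[OF b ac] P_iff[OF ac] a eq by simp
    then have "snd (g ?a') = b0" using bmult_comm bmult_cancel by metis
    then show ?thesis using P_iff[OF a'] eq by blast
  qed
  \<comment> \<open>With \<open>A\<close> and \<open>Z\<close> trivial on \<open>P\<close>, the
    product there is addition and \<open>G\<close> is additive, so it is linear with slope
    \<open>g0\<close>.\<close>
  define g0 where "g0 = G (pt 1 b0)"
  have ptP: "pt x b0 \<in> P" for x by (simp add: P_def)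
  have Gn: "G (pt (int n) b0) \<simeq> g0 * int n" for n
  proof (induction n)
    case 0
    have "G (pt 0 b0) \<simeq> A (pt 0 b0) * G (pt 0 b0) + \<chi> b0 * G (pt 0 b0)"
      using laws(4)[OF pt_carrier pt_carrier, of 0 b0 0 b0] circ.l_one[OF circ.one_closed, unfolded one] by simp
    then have "G (pt 0 b0) \<simeq> 0"
      by (rule cong_linear3[OF _ PA[OF ptP[of 0]] chi0, of _ _ _ _ "-1" "- G (pt 0 b0)" "- G (pt 0 b0)"])
        (simp add: algebra_simps)
    then show ?case by simp
  next
    case (Suc n)
    have "pt (int n) b0 \<otimes>\<^bsub>C\<^esub> pt 1 b0 = pt (int (Suc n)) b0"
      unfolding L[OF pt_carrier] snd_pt shear_b0 bmult_b0
      by (rule pt_eqI[OF _ refl], rule cong_linear3[OF PA[OF ptP[of "int n"]] fst_pt[of "int n" b0] chi0,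
        of _ _ 1 1 "G (pt (int n) b0)"]) simp
    then have "G (pt (int (Suc n)) b0) \<simeq> A (pt (int n) b0) * g0 + \<chi> b0 * G (pt (int n) b0)"
      using laws(4)[of "pt (int n) b0" "pt 1 b0"] by (simp add: g0_def)
    moreover have "A (pt (int n) b0) * g0 + \<chi> b0 * G (pt (int n) b0) \<simeq> g0 * int (Suc n)"
      by (rule cong_linear3[OF PA[OF ptP[of "int n"]] chi0 Suc, of _ _ g0 "G (pt (int n) b0)" 1])
        (simp add: algebra_simps)
    ultimately show ?case by (rule cong_trans)
  qed
  have GP: "G a \<simeq> g0 * fst a" if "a \<in> P" for a
  proof -
    have "a = pt (int (nat (fst a))) b0" "int (nat (fst a)) = fst a"
      using that pt_collapse[of a] by (auto simp: P_eq pt_def)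
    then show ?thesis using Gn[of "nat (fst a)"] by metis
  qed

  \<comment> \<open>Conjugating \<open>(1, 0)\<close> by \<open>(0, k1)\<close> keeps it in \<open>P\<close>; comparing \<open>fst\<close> and \<open>G\<close> on both sides gives \<open>g0 (g0 - 1) = 0\<close>.\<close>
  have g01: "g0 \<simeq> 0 \<or> g0 \<simeq> 1"
  proof -
    let ?b = "pt 0 k1"
    obtain a where a: "a \<in> P" and ab: "a \<otimes>\<^bsub>C\<^esub> ?b = ?b \<otimes>\<^bsub>C\<^esub> pt 1 b0" using normal[OF pt_carrier ptP] by blast
    have ac: "a \<in> carrier ?X" "snd a = b0" using a by (auto simp: P_def)
    have f1: "fst (a \<otimes>\<^bsub>C\<^esub> ?b) \<simeq> A a * fst ?b + fst a + G a * (\<chi> k1 - 1)"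
      and h1: "G (a \<otimes>\<^bsub>C\<^esub> ?b) \<simeq> A a * G ?b + \<chi> k1 * G a"
      using laws(2,4)[OF ac(1) pt_carrier[of 0 k1]] by auto
    have f2: "fst (a \<otimes>\<^bsub>C\<^esub> ?b) \<simeq> A ?b * fst (pt 1 b0) + fst ?b + G ?b * (\<chi> b0 - 1)"
      and h2: "G (a \<otimes>\<^bsub>C\<^esub> ?b) \<simeq> A ?b * g0 + \<chi> b0 * G ?b"
      using laws(2,4)[OF pt_carrier[of 0 k1] pt_carrier[of 1 b0]] by (auto simp: ab g0_def)
    have p1: "fst (pt 1 b0) = 1" "fst ?b = 0" using q_ge by (auto simp: pt_def)
    have F: "A ?b \<simeq> fst a + g0 * fst a * (\<chi> k1 - 1)"
    proof -
      have "A ?b + G ?b * (\<chi> b0 - 1) \<simeq> fst a + G a * (\<chi> k1 - 1)"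
        using cong_trans[OF cong_sym[OF f2] f1] unfolding p1 by simp
      from this GP[OF a] chi0 show ?thesis
        by (rule cong_linear3[of _ _ _ _ _ _ _ _ _ 1 "\<chi> k1 - 1" "- G ?b"]) (simp add: algebra_simps)
    qed
    have H: "A ?b * g0 + G ?b \<simeq> G ?b + \<chi> k1 * (g0 * fst a)"
    proof -
      have "A ?b * g0 + \<chi> b0 * G ?b \<simeq> A a * G ?b + \<chi> k1 * G a"
        by (rule cong_trans[OF cong_sym[OF h2] h1])
      then have "A ?b * g0 + \<chi> b0 * G ?b \<simeq> G ?b + \<chi> k1 * G a"
        by (rule cong_linear2[OF _ PA[OF a], of _ _ _ _ 1 "G ?b"]) (simp add: algebra_simps)
      from this GP[OF a] chi0 show ?thesis
        by (rule cong_linear3[of _ _ _ _ _ _ _ _ _ 1 "\<chi> k1" "- G ?b"]) (simp add: algebra_simps)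
    qed
    have "fst a * (\<chi> k1 - 1) * (g0 * (g0 - 1)) \<simeq> 0"
      by (rule cong_linear2[OF F H, of _ _ "- g0" 1]) (simp add: algebra_simps)
    moreover have "\<not> fst a \<simeq> 0"
    proof
      assume "fst a \<simeq> 0"
      then have "A ?b \<simeq> 0"
        by (rule cong_linear2[OF F, of _ _ _ _ 1 "1 + g0 * (\<chi> k1 - 1)"]) (simp add: algebra_simps)
      then show False using A0[OF pt_carrier] by blast
    qed
    ultimately have "g0 \<simeq> 0 \<or> g0 - 1 \<simeq> 0" using nt0 by (auto simp: cong_mult_0)
    then show ?thesis using cong_diff_iff_cong_0 by blast
  qed
  \<comment> \<open>Writing \<open>w\<close> and its complement \<open>v\<close>, where
    \<open>w * v = \<chi>\<close>, as polynomials in \<open>j\<close> lets both roots share the same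
    computations.\<close>
  define e where "e \<longleftrightarrow> \<not> g0 \<simeq> 0"
  define w where "w = (if e then \<chi> else (\<lambda>_. 1))"
  define v where "v = (if e then (\<lambda>_. 1) else \<chi>)"
  define j :: int where "j = (if e then 1 else 0)"
  have gj: "g0 \<simeq> j" using g01 by (auto simp: j_def e_def)
  have wj: "w k = 1 + j * (\<chi> k - 1)" and vj: "v k = \<chi> k - j * (\<chi> k - 1)" for k
    by (simp_all add: w_def v_def j_def)
  have charw: "char4 c w" using chi by (simp add: w_def)

  define \<alpha> \<gamma> z where "\<alpha> k = A (pt 0 k)" and "\<gamma> k = G (pt 0 k)" and "z k = Z (pt 0 k)" for k
  \<comment> \<open>Up to congruence, \<open>pt x k\<close> is the product of an element of
    \<open>P\<close> and \<open>pt 0 k\<close>. The first component of that element is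
    \<open>x\<close> divided by \<open>w k\<close>, because multiplying by \<open>pt 0 k\<close>
    scales it by \<open>w k\<close>.\<close>
  have coset: "A (pt x k) \<simeq> \<alpha> k \<and> G (pt x k) \<simeq> j * x + \<gamma> k \<and> Z (pt x k) = z k" for x k
  proof -
    obtain i where i: "w k * i \<simeq> 1" using char4_not_0[OF charw] cong_inverse by metis
    let ?x = "i * x"
    have gx: "G (pt ?x b0) \<simeq> j * ?x"
      by (rule cong_linear3[OF GP[OF ptP[of ?x]] gj fst_pt[of ?x b0], of _ _ 1 "fst (pt ?x b0)" j])
        (simp add: algebra_simps)
    have "pt ?x b0 \<otimes>\<^bsub>C\<^esub> pt 0 k = pt (?x + j * ?x * (\<chi> k - 1)) k"
      unfolding L[OF pt_carrier] using PZ[OF ptP]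
      by (simp, intro pt_eqI refl, intro cong_add cong_mult fst_pt gx cong_refl)
    also have "\<dots> = pt x k"
      by (rule pt_eqI[OF _ refl], rule cong_linear1[OF i, of _ _ x]) (simp add: wj algebra_simps)
    finally have p: "pt ?x b0 \<otimes>\<^bsub>C\<^esub> pt 0 k = pt x k" .
    note l = laws(3-5)[OF pt_carrier[of ?x b0] pt_carrier[of 0 k], unfolded p snd_pt]
    have "A (pt x k) \<simeq> \<alpha> k"
      by (rule cong_linear2[OF l(1) PA[OF ptP[of ?x]], of _ _ 1 "\<alpha> k"]) (simp add: \<alpha>_def algebra_simps)
    moreover have "Z (pt x k) = z k" using l(3) PZ[OF ptP] by (simp add: z_def)
    moreover have "G (pt x k) \<simeq> j * x + \<gamma> k"
    proof -
      have "G (pt x k) \<simeq> \<gamma> k + \<chi> k * (j * ?x)"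
        by (rule cong_linear3[OF l(2) PA[OF ptP[of ?x]] gx, of _ _ 1 "\<gamma> k" "\<chi> k"])
          (simp add: \<gamma>_def algebra_simps)
      then show ?thesis
        by (rule cong_linear2[OF _ i, of _ _ _ _ 1 "j * x"])
          (cases e; simp add: wj j_def algebra_simps)
    qed
    ultimately show ?thesis by blast
  qed
  have mult: "pt x k \<otimes>\<^bsub>C\<^esub> pt y m = pt (w m * x + \<alpha> k * y + \<gamma> k * (\<chi> m - 1)) (bmult c k (shear (z k) m))"
    for x k y m
  proof -
    have "pt x k \<otimes>\<^bsub>C\<^esub> pt y m = pt (A (pt x k) * y + fst (pt x k) + G (pt x k) * (\<chi> m - 1)) (bmult c k (shear (z k) m))"
      using L[OF pt_carrier, of x k y m] coset[of x k] by simp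
    also have "\<dots> = pt (\<alpha> k * y + x + (j * x + \<gamma> k) * (\<chi> m - 1)) (bmult c k (shear (z k) m))"
      using coset[of x k] by (intro pt_eqI refl cong_add cong_mult cong_refl fst_pt) auto
    also have "\<dots> = pt (w m * x + \<alpha> k * y + \<gamma> k * (\<chi> m - 1)) (bmult c k (shear (z k) m))"
      by (simp add: wj algebra_simps)
    finally show ?thesis .
  qed
  \<comment> \<open>Since \<open>Z\<close> depends on the second component only, its homomorphism
    law descends to K.\<close>
  have "z (bmult c k (shear (z k) m)) = (z k \<noteq> z m)" for k m
    using laws(5)[OF pt_carrier[of 0 k] pt_carrier[of 0 m], unfolded mult]
    unfolding conjunct2[OF conjunct2[OF coset]] .
  then obtain l where zl: "\<And>k. z k = (fst k \<and> l)" and d: "\<And>k m. bmult c k (shear (z k) m) = bmult (c \<noteq> l) k m"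
    using twisted_bmult[of z c] by blast
  define d where "d = (c \<noteq> l)"
  have mult: "pt x k \<otimes>\<^bsub>C\<^esub> pt y m = pt (w m * x + \<alpha> k * y + \<gamma> k * (\<chi> m - 1)) (bmult d k m)"
    for x k y m using mult d by (simp add: d_def)
  have chi_z: "\<chi> (shear (z k) m) \<simeq> \<chi> m" for k m using chi_sh[OF pt_carrier[of 0 k]] by (simp add: z_def)
  have chard: "char4 d \<chi>"
  proof -
    have "\<chi> (bmult d k m) \<simeq> \<chi> k * \<chi> m" for k m
      using cong_trans[OF char4_mult[OF chi, of k "shear (z k) m"] cong_scalar_left[OF chi_z]]
      by (simp add: d d_def)
    then show ?thesis using chi0 unfolding char4_def by blast
  qed
  have charv: "char4 d v" using chard by (simp add: v_def)
  have chara: "char4 d \<alpha>"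
  proof -
    have "\<alpha> (bmult d k m) \<simeq> \<alpha> k * \<alpha> m" for k m
      using cong_trans[OF cong_sym[OF conjunct1[OF coset]] laws(3)[OF pt_carrier[of 0 k] pt_carrier[of 0 m], unfolded mult]]
      by (simp add: \<alpha>_def)
    moreover have "\<alpha> b0 \<simeq> 1" using A1 one by (simp add: \<alpha>_def)
    ultimately show ?thesis unfolding char4_def by blast
  qed
  \<comment> \<open>The product of \<open>pt 0 k\<close> and \<open>pt 0 m\<close> has first
    component \<open>\<gamma> k * (\<chi> m - 1)\<close>, at which \<open>G\<close> picks up
    \<open>j\<close> times this value; moving that term across turns \<open>\<chi> m\<close> into
    \<open>v m\<close>.\<close>
  have cocycle: "\<gamma> (bmult d k m) \<simeq> \<alpha> k * \<gamma> m + v m * \<gamma> k" for k m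
  proof -
    have "G (pt (\<gamma> k * (\<chi> m - 1)) (bmult d k m)) \<simeq> \<alpha> k * \<gamma> m + \<chi> m * \<gamma> k"
      using laws(4)[OF pt_carrier[of 0 k] pt_carrier[of 0 m]] unfolding mult \<alpha>_def \<gamma>_def by simp
    moreover have "G (pt (\<gamma> k * (\<chi> m - 1)) (bmult d k m)) \<simeq> j * (\<gamma> k * (\<chi> m - 1)) + \<gamma> (bmult d k m)"
      using coset by blast
    ultimately show ?thesis
      by (rule cong_linear2[of _ _ _ _ _ _ _ 1 "-1"]) (simp add: vj algebra_simps)
  qed
  obtain s where s: "\<And>k. \<gamma> k \<simeq> s * (v k - \<alpha> k)" using cocycle_trivial[OF chara charv cocycle] by blast
  \<comment> \<open>Conjugation by \<open>pt s b0\<close> in the additive group, hence an additive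
    automorphism; it shifts the complement so that \<gamma> disappears from the product.\<close>
  define f where "f = (\<lambda>(x, k). pt (x + s * (1 - \<chi> k)) k)"
  have f: "f (pt x k) = pt (1 * x + s * (1 - \<chi> k)) (id k)" for x k
    unfolding f_def pt_def by (simp add: mod_simps)
  have fX: "f \<in> iso ?X ?X"
  proof (rule affine_iso[OF bij_id _ _ _ f])
    show "f (pt x k \<otimes>\<^bsub>?X\<^esub> pt y m) = f (pt x k) \<otimes>\<^bsub>?X\<^esub> f (pt y m)" for x k y m
      by (simp add: pt_mult f, intro pt_eqI refl, rule cong_linear1[OF char4_mult[OF chi, of k m], of _ _ "- s"])
        (simp add: algebra_simps)
  qed (simp_all add: carrier_twist not_1_0)
  have "f \<in> iso C (twist d w \<alpha>)"
  proof (rule affine_iso[OF bij_id _ _ _ f])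
    show "f (pt x k \<otimes>\<^bsub>C\<^esub> pt y m) = f (pt x k) \<otimes>\<^bsub>twist d w \<alpha>\<^esub> f (pt y m)" for x k y m
      by (simp add: pt_mult mult f, intro pt_eqI refl,
        rule cong_linear2[OF char4_mult[OF chard, of k m] s[of k], of _ _ "- s" "\<chi> m - 1"])
        (cases e; simp add: wj vj j_def algebra_simps)
  qed (simp_all add: carrier_twist cC not_1_0)
  moreover have "\<chi> (True, True) \<simeq> \<chi> (True, False)" if "d \<noteq> c"
    using chi_z[of "(True, False)" "(True, False)"] that by (cases l) (simp_all add: zl d_def shear_def)
  ultimately show ?thesis using that[OF chard chara fX] by (simp add: w_def)
qed

end

section \<open>Transporting braces and counting classes\<close>

lemma skew_brace_iso_image:
  assumes B: "skew_brace A C" and f: "f \<in> iso A A'" "f \<in> iso C C'" and G: "group A'" "group C'"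
  shows "skew_brace A' C'"
proof -
  interpret skew_brace A C by fact
  interpret A': group A' by fact
  interpret C': group C' by fact
  interpret fA: group_hom A A' f using f(1) by unfold_locales (simp add: iso_def)
  interpret fC: group_hom C C' f using f(2) by unfold_locales (simp add: iso_def)
  have im: "carrier A' = f ` carrier A" "carrier C' = f ` carrier A"
    using f by (simp_all add: iso_def bij_betw_def carrier_eq)
  show ?thesis
  proof unfold_locales
    show "carrier C' = carrier A'" by (simp add: im)
    fix a b c assume "a \<in> carrier A'" "b \<in> carrier A'" "c \<in> carrier A'"
    then obtain x y z where xyz: "a = f x" "b = f y" "c = f z"
      and m: "x \<in> carrier A" "y \<in> carrier A" "z \<in> carrier A"
      by (auto simp: im)
    have cl: "u \<otimes>\<^bsub>C\<^esub> v \<in> carrier A" if "u \<in> carrier A" "v \<in> carrier A" for u v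
      using that circ.m_closed by (simp add: carrier_eq)
    have "f (x \<otimes>\<^bsub>C\<^esub> (y \<otimes>\<^bsub>A\<^esub> z)) = f ((x \<otimes>\<^bsub>C\<^esub> y) \<otimes>\<^bsub>A\<^esub> inv\<^bsub>A\<^esub> x \<otimes>\<^bsub>A\<^esub> (x \<otimes>\<^bsub>C\<^esub> z))"
      using m brace by simp
    then show "a \<otimes>\<^bsub>C'\<^esub> (b \<otimes>\<^bsub>A'\<^esub> c) = a \<otimes>\<^bsub>C'\<^esub> b \<otimes>\<^bsub>A'\<^esub> inv\<^bsub>A'\<^esub> a \<otimes>\<^bsub>A'\<^esub> (a \<otimes>\<^bsub>C'\<^esub> c)"
      using m cl by (simp add: xyz carrier_eq)
  qed
qed

definition transport :: "('a \<Rightarrow> 'b) \<Rightarrow> 'a monoid \<Rightarrow> 'b monoid" where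
  "transport f G = \<lparr>carrier = f ` carrier G,
     mult = (\<lambda>x y. f (inv_into (carrier G) f x \<otimes>\<^bsub>G\<^esub> inv_into (carrier G) f y)), one = f \<one>\<^bsub>G\<^esub>\<rparr>"

lemma transport_iso:
  assumes "group G" "inj_on f (carrier G)"
  shows "f \<in> iso G (transport f G)" "group (transport f G)"
proof -
  interpret group G by fact
  have "f \<in> hom G (transport f G)"
    using assms(2) by (intro homI) (simp_all add: transport_def)
  then show iso: "f \<in> iso G (transport f G)"
    using assms(2) by (simp add: iso_def bij_betw_def transport_def)
  have "monoid (transport f G)"
    using assms(2) by unfold_locales (auto simp: transport_def m_assoc)
  then show "group (transport f G)"
    using iso_imp_group iso by (auto simp: is_iso_def)
qed

lemma isoD: "f \<in> iso G H \<Longrightarrow> G \<cong> H"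
  by (auto simp: is_iso_def)

text \<open>Classes can be counted over one fixed copy \<open>A0\<close> of the additive group: any
  brace is carried there along an isomorphism of its additive group, and countability carries the
  representatives back to the natural numbers.\<close>

lemma num_skew_braces_eq_card:
  fixes A0 :: "'b::countable monoid" and M :: "'i \<Rightarrow> 'b monoid"
  assumes A0X: "A0 \<cong> X" and A0: "group A0"
    and brM: "\<And>i. i \<in> I \<Longrightarrow> skew_brace A0 (M i)" and MY: "\<And>i. i \<in> I \<Longrightarrow> M i \<cong> Y"
    and inj: "\<And>i j. i \<in> I \<Longrightarrow> j \<in> I \<Longrightarrow> skew_brace_isomorphic (A0, M i) (A0, M j) \<Longrightarrow> i = j"
    and exh: "\<And>C. skew_brace A0 C \<Longrightarrow> C \<cong> Y \<Longrightarrow> \<exists>i\<in>I. skew_brace_isomorphic (A0, C) (A0, M i)"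
  shows "num_skew_braces X Y = card I"
proof -
  interpret A0: group A0 by fact
  define N where "N i = (transport to_nat A0, transport to_nat (M i))" for i
  let ?R = "skew_brace_iso_rel X Y"
  have tn: "inj_on to_nat (carrier (G :: 'b monoid))" for G by (simp add: inj_on_def)
  have N: "N i \<in> skew_braces X Y" "skew_brace_isomorphic (A0, M i) (N i)"
      "skew_brace_isomorphic (N i) (A0, M i)" if i: "i \<in> I" for i
  proof -
    interpret skew_brace A0 "M i" by (rule brM[OF i])
    note tA = transport_iso[OF A0 tn] and tC = transport_iso[OF circ.group_axioms tn]
    have B: "skew_brace (transport to_nat A0) (transport to_nat (M i))"
      by (rule skew_brace_iso_image[OF brM[OF i] tA(1) tC(1) tA(2) tC(2)])
    have "transport to_nat A0 \<cong> X" using iso_trans[OF A0.iso_sym[OF isoD[OF tA(1)]] A0X] .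
    moreover have "transport to_nat (M i) \<cong> Y"
      using iso_trans[OF circ.iso_sym[OF isoD[OF tC(1)]] MY[OF i]] .
    ultimately show "N i \<in> skew_braces X Y" using B by (simp add: skew_braces_def N_def)
    show s: "skew_brace_isomorphic (A0, M i) (N i)"
      using tA(1) tC(1) by (auto simp: skew_brace_isomorphic_def N_def)
    then show "skew_brace_isomorphic (N i) (A0, M i)"
      unfolding N_def by (rule skew_brace_isomorphic_sym[OF brM[OF i] B])
  qed
  have "bij_betw (\<lambda>i. ?R `` {N i}) I (skew_braces X Y // ?R)"
  proof (rule bij_betw_imageI)
    show "inj_on (\<lambda>i. ?R `` {N i}) I"
    proof (rule inj_onI)
      fix i j assume ij: "i \<in> I" "j \<in> I" and "?R `` {N i} = ?R `` {N j}"
      then have "(N i, N j) \<in> ?R"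
        using eq_equiv_class[OF _ equiv_skew_brace_iso_rel] N(1) by metis
      then have "skew_brace_isomorphic (N i) (N j)" by (simp add: skew_brace_iso_rel_def)
      then have "skew_brace_isomorphic (A0, M i) (A0, M j)"
        using N(2)[OF ij(1)] N(3)[OF ij(2)] skew_brace_isomorphic_trans by metis
      then show "i = j" by (rule inj[OF ij])
    qed
    show "(\<lambda>i. ?R `` {N i}) ` I = skew_braces X Y // ?R"
    proof
      show "(\<lambda>i. ?R `` {N i}) ` I \<subseteq> skew_braces X Y // ?R" using N(1) by (auto intro: quotientI)
      show "skew_braces X Y // ?R \<subseteq> (\<lambda>i. ?R `` {N i}) ` I"
      proof
        fix S assume "S \<in> skew_braces X Y // ?R"
        then obtain B where B: "B \<in> skew_braces X Y" "S = ?R `` {B}" by (auto simp: quotient_def)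
        obtain A C where AC: "B = (A, C)" "skew_brace A C" "A \<cong> X" "C \<cong> Y"
          using B(1) by (auto simp: skew_braces_def)
        interpret skew_brace A C by fact
        have "A \<cong> A0" using iso_trans[OF AC(3) A0.iso_sym[OF A0X]] .
        then obtain f where f: "f \<in> iso A A0" by (auto simp: is_iso_def)
        then have fi: "inj_on f (carrier C)" by (simp add: iso_def bij_betw_def carrier_eq)
        note t = transport_iso[OF circ.group_axioms fi]
        have B': "skew_brace A0 (transport f C)"
          by (rule skew_brace_iso_image[OF AC(2) f t(1) A0 t(2)])
        have "transport f C \<cong> Y" using iso_trans[OF circ.iso_sym[OF isoD[OF t(1)]] AC(4)] .
        then obtain i where i: "i \<in> I" "skew_brace_isomorphic (A0, transport f C) (A0, M i)"
          using exh[OF B'] by blast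
        have "skew_brace_isomorphic B (A0, transport f C)"
          using f t(1) by (auto simp: skew_brace_isomorphic_def AC)
        then have "skew_brace_isomorphic B (N i)"
          using i N(2) skew_brace_isomorphic_trans by metis
        then have "(B, N i) \<in> ?R" using B(1) N(1)[OF i(1)] by (simp add: skew_brace_iso_rel_def)
        then have "S = ?R `` {N i}" using equiv_class_eq[OF equiv_skew_brace_iso_rel] B(2) by metis
        then show "S \<in> (\<lambda>i. ?R `` {N i}) ` I" using i(1) by blast
      qed
    qed
  qed
  then show ?thesis unfolding num_skew_braces_def by (metis bij_betw_same_card)
qed

text \<open>A converse to \<open>lambda_iso\<close>: \<open>- a + a \<circ> c\<close> equals
  \<open>l a c\<close>, so the brace law is just additivity of \<open>l a\<close>.\<close>

lemma skew_braceI_lambda: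
  assumes "group A" "group C" and car: "carrier C = carrier A"
    and l: "\<And>a b. a \<in> carrier A \<Longrightarrow> b \<in> carrier A \<Longrightarrow> l a b \<in> carrier A"
    and circ: "\<And>a b. a \<in> carrier A \<Longrightarrow> b \<in> carrier A \<Longrightarrow> a \<otimes>\<^bsub>C\<^esub> b = a \<otimes>\<^bsub>A\<^esub> l a b"
    and hom: "\<And>a b c. a \<in> carrier A \<Longrightarrow> b \<in> carrier A \<Longrightarrow> c \<in> carrier A \<Longrightarrow>
      l a (b \<otimes>\<^bsub>A\<^esub> c) = l a b \<otimes>\<^bsub>A\<^esub> l a c"
  shows "skew_brace A C"
proof -
  interpret A: group A by fact
  interpret C: group C by fact
  show ?thesis
  proof unfold_locales
    fix a b c assume m: "a \<in> carrier A" "b \<in> carrier A" "c \<in> carrier A"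
    have "inv\<^bsub>A\<^esub> a \<otimes>\<^bsub>A\<^esub> (a \<otimes>\<^bsub>A\<^esub> l a c) = l a c" using m l by (simp add: A.m_assoc[symmetric])
    then show "a \<otimes>\<^bsub>C\<^esub> (b \<otimes>\<^bsub>A\<^esub> c) = a \<otimes>\<^bsub>C\<^esub> b \<otimes>\<^bsub>A\<^esub> inv\<^bsub>A\<^esub> a \<otimes>\<^bsub>A\<^esub> (a \<otimes>\<^bsub>C\<^esub> c)"
      using m l by (simp add: circ hom A.m_assoc)
  qed (rule car)
qed

section \<open>The normal forms as braces and the isomorphisms between them\<close>

context prime_1_mod_4
begin

lemma relabel_iso:
  assumes "bij \<theta>" "\<And>k m. \<theta> (bmult d k m) = bmult d' (\<theta> k) (\<theta> m)"
    and "\<And>k. w' (\<theta> k) \<simeq> w k" "\<And>k. \<alpha>' (\<theta> k) \<simeq> \<alpha> k"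
  shows "(\<lambda>(x, k). (x, \<theta> k)) \<in> iso (twist d w \<alpha>) (twist d' w' \<alpha>')"
proof -
  have F: "(case pt x k of (x, k) \<Rightarrow> (x, \<theta> k)) = pt (1 * x + 0) (\<theta> k)" for x k by (simp add: pt_def)
  show ?thesis
  proof (rule affine_iso[OF assms(1) _ _ _ F])
    fix x k y m
    show "(case pt x k \<otimes>\<^bsub>twist d w \<alpha>\<^esub> pt y m of (x, k) \<Rightarrow> (x, \<theta> k)) =
        (case pt x k of (x, k) \<Rightarrow> (x, \<theta> k)) \<otimes>\<^bsub>twist d' w' \<alpha>'\<^esub> (case pt y m of (x, k) \<Rightarrow> (x, \<theta> k))"
      unfolding pt_mult F assms(2) by (intro pt_eqI refl)
        (simp, intro cong_add cong_mult cong_refl cong_sym[OF assms(3)] cong_sym[OF assms(4)])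
  qed (simp_all add: carrier_twist not_1_0)
qed

text \<open>Scaling the coset of \<open>k\<close> by \<open>w k\<close> produces the factor
  \<open>w m\<close> on the left argument, and multiplies the acting character by \<open>w\<close>.
  So \<psi> alone decides the type of the multiplicative group.\<close>

lemma untwist_iso:
  assumes "char4 d w" "char4 d \<psi>"
  shows "split4 d \<psi> \<cong> twist d w (\<lambda>k. \<psi> k * w k)" 
proof -
  define F where "F = (\<lambda>(x, k). pt (w k * x) k)"
  have F: "F (pt x k) = pt (w k * x + 0) (id k)" for x k
    unfolding F_def pt_def by (simp add: mod_simps)
  have "F \<in> iso (split4 d \<psi>) (twist d w (\<lambda>k. \<psi> k * w k))"
  proof (rule affine_iso[OF bij_id _ _ _ F])
    show "F (pt x k \<otimes>\<^bsub>split4 d \<psi>\<^esub> pt y m) = F (pt x k) \<otimes>\<^bsub>twist d w (\<lambda>k. \<psi> k * w k)\<^esub> F (pt y m)" for x k y m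
      by (simp add: pt_mult F, intro pt_eqI refl,
          rule cong_linear1[OF char4_mult[OF assms(1), of k m], of _ _ "x + \<psi> k * y"]) (simp add: algebra_simps)
  qed (simp_all add: carrier_twist char4_not_0[OF assms(1)])
  then show ?thesis by (rule isoD)
qed

definition side :: "bool \<Rightarrow> (bits \<Rightarrow> int) \<Rightarrow> bits \<Rightarrow> int" where
  "side e \<chi> = (if e then \<chi> else (\<lambda>_. 1))"

lemma char4_side: "char4 d \<chi> \<Longrightarrow> char4 d (side e \<chi>)"
  by (simp add: side_def)

lemma skew_brace_twist:
  assumes chi: "char4 c \<chi>" and chid: "char4 d \<chi>" and al: "char4 d \<alpha>"
    and sh: "\<And>m. d \<noteq> c \<Longrightarrow> \<chi> (shear True m) \<simeq> \<chi> m"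
  shows "skew_brace (split4 c \<chi>) (twist d (side e \<chi>) \<alpha>)"
proof -
  let ?w = "side e \<chi>" and ?z = "\<lambda>k. fst k \<and> d \<noteq> c"
  \<comment> \<open>Obtained by solving \<open>a \<circ> b = a + l a b\<close>: the cube of \<chi>
    is its inverse, and the shear makes up for the difference between the carries of
    \<open>c\<close> and \<open>d\<close>.\<close>
  define l where "l a b = pt (\<chi> (snd a) ^ 3 * (\<alpha> (snd a) * fst b + (?w (snd b) - 1) * fst a)) (shear (?z (snd a)) (snd b))"
    for a b
  have l: "l (pt x k) (pt y m) = pt (\<chi> k ^ 3 * (\<alpha> k * y + (?w m - 1) * x)) (shear (?z k) m)" for x k y m
    unfolding l_def by (intro pt_eqI cong_mult cong_add cong_refl fst_pt) auto
  have shz: "\<chi> (shear (?z k) m) \<simeq> \<chi> m" for k m using sh by (cases "?z k") auto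
  have dz: "bmult d k m = bmult c k (shear (?z k) m)" for k m by (auto simp: bmult_def shear_def)
  have ww: "?w (bmult c m m') - 1 \<simeq> (?w m - 1) + \<chi> m * (?w m' - 1)" for m m'
  proof (cases e)
    case True
    then show ?thesis using cong_diff[OF char4_mult[OF chi, of m m'] cong_refl[of 1]]
      by (simp add: side_def algebra_simps)
  qed (simp add: side_def)
  show ?thesis
  proof (rule skew_braceI_lambda[where l = l])
    show "group (split4 c \<chi>)" "group (twist d (side e \<chi>) \<alpha>)"
      using chi chid al by (simp_all add: group_twist char4_side)
    show "carrier (twist d (side e \<chi>) \<alpha>) = carrier (split4 c \<chi>)" by (simp add: carrier_twist)
    fix a b assume "a \<in> carrier (split4 c \<chi>)" "b \<in> carrier (split4 c \<chi>)"
    then obtain x k y m where ab: "a = pt x k" "b = pt y m" by (elim pt_cases)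
    show "l a b \<in> carrier (split4 c \<chi>)" by (simp add: l_def)
    show "a \<otimes>\<^bsub>twist d (side e \<chi>) \<alpha>\<^esub> b = a \<otimes>\<^bsub>split4 c \<chi>\<^esub> l a b"
      unfolding ab l pt_mult dz
      by (intro pt_eqI refl,
          rule cong_linear1[OF char4_pow4[OF chi, of k], of _ _ "- (\<alpha> k * y + (?w m - 1) * x)"])
        (simp add: algebra_simps eval_nat_numeral)
    fix a' assume "a' \<in> carrier (split4 c \<chi>)"
    then obtain y' m' where a': "a' = pt y' m'" by (elim pt_cases)
    show "l a (b \<otimes>\<^bsub>split4 c \<chi>\<^esub> a') = l a b \<otimes>\<^bsub>split4 c \<chi>\<^esub> l a a'"
      unfolding ab a' l pt_mult shear_bmult
      by (intro pt_eqI refl,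
          rule cong_linear2[OF ww[of m m'] shz[of k m], of _ _ "\<chi> k ^ 3 * x"
            "- (\<chi> k ^ 3 * (\<alpha> k * y' + (?w m' - 1) * x))"]) (simp add: algebra_simps)
  qed
qed

text \<open>A brace isomorphism is an additive automorphism, hence affine. Products of
  \<open>pt x b0\<close> with \<open>pt 0 m\<close> show that it respects \<open>side\<close>, which
  separates \<open>e\<close> from \<open>e'\<close> as \<chi> is nontrivial; products in the other
  order then give the characters.\<close>

lemma twist_isomorphic_form:
  assumes chi: "char4 c \<chi>" and nt: "\<not> \<chi> k1 \<simeq> 1"
    and w: "char4 d (side e \<chi>)" and psi: "char4 d \<psi>" "char4 d' \<psi>'"
    and iso: "skew_brace_isomorphic (split4 c \<chi>, twist d (side e \<chi>) (\<lambda>k. \<psi> k * side e \<chi> k))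
        (split4 c \<chi>, twist d' (side e' \<chi>) (\<lambda>k. \<psi>' k * side e' \<chi> k))"
  obtains \<theta> where "bij \<theta>" "\<And>k m. \<theta> (bmult c k m) = bmult c (\<theta> k) (\<theta> m)"
    "\<And>k m. \<theta> (bmult d k m) = bmult d' (\<theta> k) (\<theta> m)"
    "\<And>k. \<chi> (\<theta> k) \<simeq> \<chi> k" "\<And>k. \<psi>' (\<theta> k) \<simeq> \<psi> k" "e' = e"
proof -
  let ?C = "twist d (side e \<chi>) (\<lambda>k. \<psi> k * side e \<chi> k)"
  let ?C' = "twist d' (side e' \<chi>) (\<lambda>k. \<psi>' k * side e' \<chi> k)"
  obtain f where f: "f \<in> iso (split4 c \<chi>) (split4 c \<chi>)" "f \<in> iso ?C ?C'"
    using iso by (auto simp: skew_brace_isomorphic_def)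
  have fm: "f (pt x k \<otimes>\<^bsub>?C\<^esub> pt y m) = f (pt x k) \<otimes>\<^bsub>?C'\<^esub> f (pt y m)" for x k y m
    using f(2) by (simp add: iso_def hom_mult)
  show thesis
  proof (rule iso_split4_form[OF chi chi f(1)], goal_cases)
    case (1 a t \<theta>)
    note F = 1(1) and a = 1(2) and th = 1(3,4) and ct = 1(5)
    have t0: "t b0 \<simeq> 0"
      by (rule cong_linear2[OF 1(6)[of b0 b0] char4_b0[OF chi], of _ _ "-1" "- t b0"]) (simp add: algebra_simps)
    have th0: "\<theta> b0 = b0" using th(2)[of b0 b0] by (metis bmult_cancel bmult_b0(1,2))
    have thd: "\<theta> (bmult d k m) = bmult d' (\<theta> k) (\<theta> m)" for k m
      using fm[of 0 k 0 m] by (simp add: pt_mult F pt_eq_iff)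
    have fx: "a * (side e \<chi> m * x) + t m \<simeq> side e' \<chi> (\<theta> m) * (a * x) + t m" for m x
    proof -
      have p: "f (pt x b0) = pt (a * x) b0" unfolding F th0
        by (intro pt_eqI refl, rule cong_linear1[OF t0, of _ _ 1]) simp
      have "f (pt (side e \<chi> m * x) m) = pt (a * x) b0 \<otimes>\<^bsub>?C'\<^esub> f (pt 0 m)"
        using fm[of x b0 0 m] by (simp add: pt_mult p)
      then have e1: "a * (side e \<chi> m * x) + t m \<simeq> side e' \<chi> (\<theta> m) * (a * x) + \<psi>' b0 * side e' \<chi> b0 * t m"
        by (simp add: pt_mult F pt_eq_iff)
      have "side e' \<chi> b0 \<simeq> 1" using char4_b0[OF chi] by (simp add: side_def)
      then have "\<psi>' b0 * side e' \<chi> b0 \<simeq> 1"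
        using cong_mult[OF char4_b0[OF psi(2)]] by fastforce
      with e1 show ?thesis
        by (rule cong_linear2[of _ _ _ _ _ _ _ 1 "t m"]) (simp add: algebra_simps)
    qed
    have side: "side e' \<chi> (\<theta> m) \<simeq> side e \<chi> m" for m
    proof -
      have "a * side e' \<chi> (\<theta> m) \<simeq> a * side e \<chi> m"
        by (rule cong_linear1[OF fx[of m 1], of _ _ "-1"]) (simp add: algebra_simps)
      then show ?thesis using cong_cancel[OF a] by blast
    qed
    have ee: "e' = e"
    proof (rule ccontr)
      assume "e' \<noteq> e"
      then have "\<chi> k1 \<simeq> 1" using side[of k1] ct[of k1] unfolding side_def
        by (cases e; cases e'; simp) (metis cong_sym cong_trans)+
      then show False using nt by blast
    qed
    have "\<psi>' (\<theta> k) \<simeq> \<psi> k" for k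
    proof -
      have p: "f (pt 1 b0) = pt a b0" unfolding F th0
        by (intro pt_eqI refl, rule cong_linear1[OF t0, of _ _ 1]) simp
      have "f (pt (\<psi> k * side e \<chi> k) k) = f (pt 0 k) \<otimes>\<^bsub>?C'\<^esub> pt a b0"
        using fm[of 0 k 1 b0] by (simp add: pt_mult p)
      then have e1: "a * (\<psi> k * side e \<chi> k) + t k \<simeq> side e' \<chi> b0 * t k + \<psi>' (\<theta> k) * side e' \<chi> (\<theta> k) * a"
        by (simp add: pt_mult F pt_eq_iff)
      have e2: "side e' \<chi> b0 \<simeq> 1" using char4_b0[OF chi] by (simp add: side_def)
      have "(a * side e \<chi> k) * \<psi>' (\<theta> k) \<simeq> (a * side e \<chi> k) * \<psi> k"
        by (rule cong_linear3[OF e1 e2 side[of k], of _ _ "-1" "- t k" "- \<psi>' (\<theta> k) * a"])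
          (simp add: algebra_simps)
      moreover have "\<not> a * side e \<chi> k \<simeq> 0" using a char4_not_0[OF w] by (simp add: cong_mult_0)
      ultimately show ?thesis using cong_cancel by blast
    qed
    then show ?case using that[OF th thd ct] ee by blast
  qed
qed

end

section \<open>Characters and the five groups\<close>

definition chr :: "int \<Rightarrow> int \<Rightarrow> bits \<Rightarrow> int" where
  "chr a b k = (if fst k then a else 1) * (if snd k then b else 1)"

lemma chr_simps [simp]: "chr a b b0 = 1" "chr a b (True, False) = a" "chr a b (False, True) = b"
    "chr a b (True, True) = a * b"
  by (simp_all add: chr_def)

definition val :: "bits \<Rightarrow> int" where
  "val k = of_bool (fst k) + 2 * of_bool (snd k)"

lemma bij_val: "bij_betw val UNIV {0..<4}"
proof (rule bij_betw_imageI)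
  show "inj_on val UNIV" by (rule inj_onI) (auto simp: val_def prod_eq_iff of_bool_def split: if_splits)
  have "{0..<4::int} = {val b0, val (True, False), val (False, True), val (True, True)}"
    by (auto simp: val_def)
  then show "range val = {0..<4}" using bits_exhaust[of "\<lambda>k. val k \<in> {0..<4}"] by auto
qed

lemma val_bmult: "val (bmult True k m) = (val k + val m) mod 4"
  by (auto simp: val_def bmult_def of_bool_def)

context prime_1_mod_4
begin

text \<open>The hypotheses are the defining relations: twice \<open>(True, False)\<close> is
  \<open>(False, True)\<close> in Z_4 and \<open>b0\<close> in Z_2^2.\<close>

lemma char4_chr:
  assumes "b * b \<simeq> 1" "a * a \<simeq> (if d then b else 1)"
  shows "char4 d (chr a b)"
proof -
  let ?b = "if d then b else 1"
  have 1: "1 \<simeq> b * b" and 2: "?b \<simeq> a * a" using assms by (simp_all add: cong_sym)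
  have 3: "a \<simeq> a * b * b" "a \<simeq> b * (a * b)"
    by (rule cong_linear1[OF 1, of _ _ a], simp add: algebra_simps)+
  have 4: "?b * b \<simeq> a * (a * b)" "?b * b \<simeq> a * b * a"
    by (rule cong_linear1[OF 2, of _ _ b], simp add: algebra_simps)+
  have 5: "?b \<simeq> a * b * (a * b)"
    by (rule cong_linear2[OF 2 1, of _ _ "b * b" ?b]) (simp add: algebra_simps)
  have 6: "a * b \<simeq> b * a" by (simp add: mult.commute)
  have 7: "d \<Longrightarrow> 1 \<simeq> ?b * b" using 1 by simp
  have 8: "d \<Longrightarrow> 1 \<simeq> a * (a * b)" "d \<Longrightarrow> 1 \<simeq> a * b * a"
    using 7 4 cong_trans by blast+
  have "\<forall>k m. chr a b (bmult d k m) \<simeq> chr a b k * chr a b m"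
    unfolding bits_exhaust using 1 2 3 4 5 6 8 by (cases d; simp add: bmult_def)
  then show ?thesis unfolding char4_def by simp
qed

lemma char4_eq_chr:
  assumes "char4 d \<psi>"
  shows "\<psi> k \<simeq> chr (\<psi> (True, False)) (\<psi> (False, True)) k"
    "\<psi> (False, True) * \<psi> (False, True) \<simeq> 1"
    "\<psi> (True, False) * \<psi> (True, False) \<simeq> (if d then \<psi> (False, True) else 1)"
proof -
  have 0: "\<psi> b0 \<simeq> 1" by (rule char4_b0[OF assms])
  have "\<psi> (True, True) \<simeq> \<psi> (True, False) * \<psi> (False, True)"
    using char4_mult[OF assms, of "(True, False)" "(False, True)"] by (simp add: bmult_def)
  then have "\<forall>k. \<psi> k \<simeq> chr (\<psi> (True, False)) (\<psi> (False, True)) k"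
    unfolding bits_exhaust using 0 by simp
  then show "\<psi> k \<simeq> chr (\<psi> (True, False)) (\<psi> (False, True)) k" by blast
  have "\<psi> b0 \<simeq> \<psi> (False, True) * \<psi> (False, True)"
    using char4_mult[OF assms, of "(False, True)" "(False, True)"] by (simp add: bmult_def)
  then show "\<psi> (False, True) * \<psi> (False, True) \<simeq> 1" using 0 cong_sym cong_trans by blast
  have "\<psi> (False, d) \<simeq> \<psi> (True, False) * \<psi> (True, False)"
    using char4_mult[OF assms, of "(True, False)" "(True, False)"] by (simp add: bmult_def)
  moreover have "\<psi> (False, d) \<simeq> (if d then \<psi> (False, True) else 1)" using 0 by simp
  ultimately show "\<psi> (True, False) * \<psi> (True, False) \<simeq> (if d then \<psi> (False, True) else 1)"
    using cong_sym cong_trans by blast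
qed

lemma chr_cong: "a \<simeq> a' \<Longrightarrow> b \<simeq> b' \<Longrightarrow> chr a b k \<simeq> chr a' b' k"
  unfolding chr_def by (intro cong_mult) auto

lemma cong_square_eq:
  assumes "a * a \<simeq> b * b" shows "a \<simeq> b \<or> a \<simeq> - b"
proof -
  have "(a - b) * (a + b) \<simeq> 0"
    by (rule cong_linear1[OF assms, of _ _ 1]) (simp add: algebra_simps)
  then show ?thesis using cong_mult_0 cong_diff_iff_cong_0[of a b] cong_diff_iff_cong_0[of a "- b"] by simp
qed

lemma cyclic_semidirect_iso_split4:
  assumes "[u ^ 4 = 1] (mod int q)"
  shows "split4 True (chr u (u ^ 2)) \<cong> cyclic_semidirect q 4 u"
proof -
  let ?G = "split4 True (chr u (u ^ 2))" and ?H = "cyclic_semidirect q 4 u"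
  define F :: "int \<times> bits \<Rightarrow> int \<times> int" where "F = map_prod id val"
  have u: "chr u (u ^ 2) k = u ^ nat (val k)" for k
    by (auto simp: chr_def val_def of_bool_def eval_nat_numeral)
  have "bij_betw F (carrier ?G) (carrier ?H)"
    using bij_betw_map_prod[OF bij_betw_id[of "{0..<int q}"] bij_val] q_ge
    by (simp add: F_def carrier_twist cyclic_semidirect_def semidirect_product_def carrier_integer_mod_group)
  moreover have "F \<in> hom ?G ?H"
  proof (rule homI)
    fix a b assume ab: "a \<in> carrier ?G" "b \<in> carrier ?G"
    show "F a \<in> carrier ?H" using ab(1) calculation by (rule bij_betw_apply[rotated])
    obtain x k y m where "a = (x, k)" "b = (y, m)" by (cases a; cases b)
    then show "F (a \<otimes>\<^bsub>?G\<^esub> b) = F a \<otimes>\<^bsub>?H\<^esub> F b"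
      by (simp add: F_def twist_def pt_def cyclic_semidirect_def semidirect_product_def u val_bmult mod_simps)
  qed
  ultimately show ?thesis by (auto simp: is_iso_def iso_def)
qed

text \<open>Chinese remaindering for the coprime factors \<open>q\<close> and 4, with the residue
  modulo 4 written in bits.\<close>

lemma integer_mod_group_iso_split4: "split4 True (\<lambda>_. 1) \<cong> integer_mod_group (4 * q)"
proof -
  let ?G = "integer_mod_group (4 * q)" and ?H = "split4 True (\<lambda>_. 1)"
  have c4: "coprime (int q) 4"
    using q_mod_4 by (metis coprime_1_left coprime_mod_left_iff of_nat_1 of_nat_mod of_nat_numeral zero_neq_numeral)
  define bt :: "int \<Rightarrow> bits" where "bt n = (odd n, odd (n div 2))" for n
  have val_bt: "val (bt n) = n mod 4" for n
    by (simp add: bt_def val_def of_bool_def) presburger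
  have inj: "val k = val m \<Longrightarrow> k = m" for k m using bij_val by (meson UNIV_I bij_betw_imp_inj_on injD)
  have bt_eq: "bt n = bt m \<longleftrightarrow> n mod 4 = m mod 4" for n m using val_bt inj by metis
  define F where "F n = pt n (bt n)" for n
  have car: "carrier ?G = {0..<4 * int q}" using q_ge by (simp add: carrier_integer_mod_group)
  have inj: "inj_on F (carrier ?G)"
  proof (rule inj_onI)
    fix n m assume nm: "n \<in> carrier ?G" "m \<in> carrier ?G" and "F n = F m"
    then have "n \<simeq> m" "[n = m] (mod 4)" by (simp_all add: F_def pt_eq_iff bt_eq cong_def)
    then have "[n = m] (mod (int q * 4))" using c4 by (rule coprime_cong_mult)
    then show "n = m" using nm unfolding car by (simp add: cong_def mult.commute)
  qed
  have "F ` carrier ?G = carrier ?H"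
  proof (rule card_subset_eq[OF finite_twist])
    show "F ` carrier ?G \<subseteq> carrier ?H" by (auto simp: F_def)
    show "card (F ` carrier ?G) = card (carrier ?H)" using inj by (simp add: card_image card_twist car)
  qed
  moreover have "F \<in> hom ?G ?H"
  proof (rule homI)
    show "F n \<in> carrier ?H" for n by (simp add: F_def)
    fix n m
    have "n + m \<simeq> (n + m) mod int (4 * q)" 
      by (metis cong_mod_right cong_modulus_mult cong_refl mult.commute of_nat_mult)
    moreover have "val (bt ((n + m) mod int (4 * q))) = val (bmult True (bt n) (bt m))"
      by (simp add: val_bt val_bmult mod_mod_cancel mod_simps)
    ultimately show "F (n \<otimes>\<^bsub>?G\<^esub> m) = F n \<otimes>\<^bsub>?H\<^esub> F m"
      using \<open>\<And>k m. val k = val m \<Longrightarrow> k = m\<close> by (simp add: F_def pt_mult pt_eq_iff cong_sym)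
  qed
  ultimately have "?G \<cong> ?H" using inj by (auto simp: is_iso_def iso_def bij_betw_def)
  then show ?thesis by (rule group.iso_sym[OF group_integer_mod_group])
qed

lemma bit_cases: "0 \<le> a \<Longrightarrow> a < 2 \<Longrightarrow> \<exists>s. (s \<longrightarrow> a = 1) \<and> (\<not> s \<longrightarrow> a = 0)" for a :: int
  by (intro exI[of _ "a = 1"]) auto

lemma product_iso_split4:
  "split4 False (\<lambda>_. 1) \<cong> (integer_mod_group 2 \<times>\<times> integer_mod_group 2) \<times>\<times> integer_mod_group q"
proof -
  let ?G = "split4 False (\<lambda>_. 1)"
  let ?H = "(integer_mod_group 2 \<times>\<times> integer_mod_group 2) \<times>\<times> integer_mod_group q"
  define F :: "int \<times> bits \<Rightarrow> (int \<times> int) \<times> int" where "F = (\<lambda>(x, (s, t)). ((of_bool s, of_bool t), x))"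
  have "bij_betw F (carrier ?G) (carrier ?H)"
    unfolding bij_betw_def
  proof
    show "inj_on F (carrier ?G)" by (auto simp: inj_on_def F_def)
    show "F ` carrier ?G = carrier ?H" using q_ge
      by (auto simp: F_def carrier_twist carrier_integer_mod_group image_iff of_bool_def
        split: if_splits intro!: bit_cases)
  qed
  moreover have "F \<in> hom ?G ?H"
  proof (rule homI)
    fix a b assume ab: "a \<in> carrier ?G" "b \<in> carrier ?G"
    show "F a \<in> carrier ?H" using ab(1) calculation by (rule bij_betw_apply[rotated])
    obtain x s t y s' t' where "a = (x, (s, t))" "b = (y, (s', t'))" by (metis surj_pair)
    then show "F (a \<otimes>\<^bsub>?G\<^esub> b) = F a \<otimes>\<^bsub>?H\<^esub> F b"
      by (auto simp: F_def twist_def pt_def bmult_def of_bool_def)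
  qed
  ultimately show ?thesis by (auto simp: is_iso_def iso_def)
qed

lemma dihedral_product_iso_split4:
  "split4 False (chr (-1) 1) \<cong> integer_mod_group 2 \<times>\<times> cyclic_semidirect q 2 (-1)"
proof -
  let ?G = "split4 False (chr (-1) 1)"
  let ?H = "integer_mod_group 2 \<times>\<times> cyclic_semidirect q 2 (-1)"
  define F :: "int \<times> bits \<Rightarrow> int \<times> int \<times> int" where "F = (\<lambda>(x, (s, t)). (of_bool t, (x, of_bool s)))"
  have "bij_betw F (carrier ?G) (carrier ?H)"
    unfolding bij_betw_def
  proof
    show "inj_on F (carrier ?G)" by (auto simp: inj_on_def F_def)
    show "F ` carrier ?G = carrier ?H" using q_ge
      by (auto simp: F_def carrier_twist cyclic_semidirect_def semidirect_product_def
        carrier_integer_mod_group image_iff of_bool_def split: if_splits intro!: bit_cases)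
  qed
  moreover have "F \<in> hom ?G ?H"
  proof (rule homI)
    fix a b assume ab: "a \<in> carrier ?G" "b \<in> carrier ?G"
    show "F a \<in> carrier ?H" using ab(1) calculation by (rule bij_betw_apply[rotated])
    obtain x s t y s' t' where "a = (x, (s, t))" "b = (y, (s', t'))" by (metis surj_pair)
    then show "F (a \<otimes>\<^bsub>?G\<^esub> b) = F a \<otimes>\<^bsub>?H\<^esub> F b"
      by (auto simp: F_def twist_def pt_def bmult_def of_bool_def chr_def cyclic_semidirect_def
        semidirect_product_def mod_simps)
  qed
  ultimately show ?thesis by (auto simp: is_iso_def iso_def)
qed

end

section \<open>Representatives and the count\<close>

locale prime_1_mod_4_root = prime_1_mod_4 +
  fixes h :: int
  assumes h_square: "[h * h = -1] (mod int q)"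
begin

lemma not_1_minus_1: "\<not> 1 \<simeq> - 1"
  using not_2_0 cong_diff_iff_cong_0[of 1 "-1" "int q"] by simp

text \<open>Squares separate 1 and -1 from \<open>h\<close> and \<open>- h\<close>. Both
  orientations are listed for use in simplification.\<close>

lemma roots_distinct:
  "\<not> 1 \<simeq> - 1" "\<not> - 1 \<simeq> 1" "\<not> h \<simeq> 1" "\<not> 1 \<simeq> h" "\<not> h \<simeq> - 1" "\<not> - 1 \<simeq> h"
  "\<not> - h \<simeq> 1" "\<not> 1 \<simeq> - h" "\<not> - h \<simeq> - 1" "\<not> - 1 \<simeq> - h" "\<not> h \<simeq> - h" "\<not> - h \<simeq> h"
proof -
  have sq: "\<not> x \<simeq> y" if "x * x \<simeq> 1" "y * y \<simeq> -1" for x y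
  proof
    assume "x \<simeq> y"
    then have "x * x \<simeq> y * y" by (intro cong_mult)
    then show False using that not_1_minus_1 cong_sym cong_trans by blast
  qed
  have h0: "\<not> h \<simeq> 0"
  proof
    assume "h \<simeq> 0"
    then have "-1 \<simeq> 0" by (rule cong_linear2[OF _ h_square, of _ _ _ _ h "-1"]) simp
    then show False using not_1_0 by (simp add: cong_0_iff)
  qed
  show a: "\<not> h \<simeq> - h"
  proof
    assume "h \<simeq> - h"
    then have "2 * h \<simeq> 0" by (rule cong_linear1[where c = 1]) simp
    then show False using h0 not_2_0 by (simp add: cong_mult_0)
  qed
  show b: "\<not> 1 \<simeq> - 1" by (rule not_1_minus_1)
  show c: "\<not> 1 \<simeq> h" "\<not> - 1 \<simeq> h" "\<not> 1 \<simeq> - h" "\<not> - 1 \<simeq> - h"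
    by (rule sq; simp add: h_square)+
  show "\<not> - 1 \<simeq> 1" "\<not> h \<simeq> 1" "\<not> h \<simeq> - 1" "\<not> - h \<simeq> 1" "\<not> - h \<simeq> - 1" "\<not> - h \<simeq> h"
    using a b c cong_sym by blast+
qed

text \<open>Up to congruence \<open>rep d j (j < 4)\<close> are all characters of \<open>ext4 d\<close>. Number 3 is number 2 composed
  with \<open>shear True\<close>, so for a quadratic \<open>\<chi>\<close>, which the shear fixes, only three classes remain.\<close>

definition rep :: "bool \<Rightarrow> nat \<Rightarrow> bits \<Rightarrow> int" where
  "rep d j = (if j = 0 then chr 1 1 else if j = 1 then chr (-1) 1
     else if j = 2 then chr (if d then h else 1) (-1) else chr (if d then - h else - 1) (-1))"

lemma char4_rep: "char4 d (rep d j)"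
  using h_square by (auto simp: rep_def intro!: char4_chr)

lemma rep_exhaust:
  assumes "char4 d \<psi>"
  obtains j where "j < 4" "\<And>k. \<psi> k \<simeq> rep d j k"
proof -
  let ?a = "\<psi> (True, False)" and ?b = "\<psi> (False, True)"
  note chr = char4_eq_chr[OF assms]
  have b: "?b \<simeq> 1 \<or> ?b \<simeq> - 1" using chr(2) by (intro cong_square_eq) simp
  have "\<exists>j<4. \<exists>a b. ?a \<simeq> a \<and> ?b \<simeq> b \<and> rep d j = chr a b"
  proof (cases "d \<and> \<not> ?b \<simeq> 1")
    case True
    then have b': "?b \<simeq> - 1" using b by blast
    have "?a * ?a \<simeq> ?b" using chr(3) True by simp
    then have "?a * ?a \<simeq> h * h" using cong_trans[OF b' cong_sym[OF h_square]] by (rule cong_trans)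
    then have "?a \<simeq> h \<or> ?a \<simeq> - h" by (rule cong_square_eq)
    then show ?thesis
    proof
      assume "?a \<simeq> h"
      then show ?thesis using b' True by (intro exI[of _ 2]) (auto simp: rep_def)
    next
      assume "?a \<simeq> - h"
      then show ?thesis using b' True by (intro exI[of _ 3]) (auto simp: rep_def)
    qed
  next
    case False
    have "?a * ?a \<simeq> 1 * 1" using chr(3) False cong_trans by (cases d) auto
    then have a: "?a \<simeq> 1 \<or> ?a \<simeq> - 1" by (rule cong_square_eq)
    show ?thesis
    proof (cases "?b \<simeq> 1")
      case True
      from a show ?thesis
      proof
        assume "?a \<simeq> 1"
        then show ?thesis using True by (intro exI[of _ 0]) (auto simp: rep_def)
      next
        assume "?a \<simeq> - 1"
        then show ?thesis using True by (intro exI[of _ 1]) (auto simp: rep_def)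
      qed
    next
      case b1: False
      then have b': "?b \<simeq> - 1" using b by blast
      from a show ?thesis
      proof
        assume "?a \<simeq> 1"
        then show ?thesis using b' b1 False by (intro exI[of _ 2]) (auto simp: rep_def)
      next
        assume "?a \<simeq> - 1"
        then show ?thesis using b' b1 False by (intro exI[of _ 3]) (auto simp: rep_def)
      qed
    qed
  qed
  then obtain j a b where j: "j < 4" "?a \<simeq> a" "?b \<simeq> b" "rep d j = chr a b" by blast
  have "\<psi> k \<simeq> rep d j k" for k
    unfolding j(4) by (rule cong_trans[OF chr(1) chr_cong[OF j(2,3)]])
  then show ?thesis using that j(1) by blast
qed

lemma rep_3_shear: "rep d 2 (shear True k) \<simeq> rep d 3 k"
proof -
  have "\<forall>k. rep d 2 (shear True k) = rep d 3 k"
    unfolding bits_exhaust by (simp add: rep_def shear_def)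
  then have "rep d 2 (shear True k) = rep d 3 k" by blast
  then show ?thesis by (simp only: cong_refl)
qed

text \<open>Index of a standard character with an isomorphic split extension: the two faithful
  characters of Z_4 are merged, and so are all nontrivial characters of Z_2^2.\<close>

definition kind :: "bool \<Rightarrow> nat \<Rightarrow> nat" where
  "kind d j = (if j < 2 then j else if d then 2 else 1)"

lemma rep_trivial_iff: "(\<forall>k. rep d j k \<simeq> 1) \<longleftrightarrow> j = 0"
  unfolding bits_exhaust by (auto simp: rep_def roots_distinct)

lemma rep_quadratic_iff: "(\<forall>k. rep d j k * rep d j k \<simeq> 1) \<longleftrightarrow> j < 2 \<or> \<not> d"
proof -
  have "\<not> h * h \<simeq> 1" using h_square roots_distinct(2) cong_sym cong_trans by blast
  then show ?thesis unfolding bits_exhaust by (auto simp: rep_def)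
qed

lemma bmult_square_iff: "(\<forall>k. bmult d k k = b0) \<longleftrightarrow> \<not> d"
  unfolding bits_exhaust by (auto simp: bmult_def)

lemma bij_hom_extension_eq:
  assumes "bij \<theta>" "\<And>k m. \<theta> (bmult d k m) = bmult d' (\<theta> k) (\<theta> m)"
  shows "d' = d"
proof -
  have 0: "\<theta> b0 = b0" using assms(2)[of b0 b0] by (metis bmult_cancel bmult_b0(1,2))
  have "bmult d k k = b0 \<longleftrightarrow> bmult d' (\<theta> k) (\<theta> k) = b0" for k
    using assms 0 by (metis bij_pointE)
  then have "(\<forall>k. bmult d k k = b0) \<longleftrightarrow> (\<forall>k. bmult d' k k = b0)"
    using assms(1) by (metis bij_pointE)
  then show ?thesis by (simp only: bmult_square_iff) blast
qed

text \<open>Being trivial and having trivial square survive any relabelling, and these two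
  properties determine \<open>kind\<close>.\<close>

lemma rep_transfer:
  assumes "bij \<theta>" "\<And>k. rep d j' (\<theta> k) \<simeq> rep d j k"
  shows "j' = 0 \<longleftrightarrow> j = 0" "kind d j' = kind d j"
proof -
  have all: "(\<forall>k. P (\<theta> k)) \<longleftrightarrow> (\<forall>k. P k)" for P using assms(1) by (metis bij_pointE)
  have "(\<forall>k. rep d j k \<simeq> 1) \<longleftrightarrow> (\<forall>k. rep d j' (\<theta> k) \<simeq> 1)"
    using assms(2) cong_sym cong_trans by blast
  then show z: "j' = 0 \<longleftrightarrow> j = 0" using all[of "\<lambda>k. rep d j' k \<simeq> 1"] rep_trivial_iff by simp
  have "rep d j' (\<theta> k) * rep d j' (\<theta> k) \<simeq> rep d j k * rep d j k" for k
    by (intro cong_mult assms)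
  then have "(\<forall>k. rep d j k * rep d j k \<simeq> 1) \<longleftrightarrow> (\<forall>k. rep d j' (\<theta> k) * rep d j' (\<theta> k) \<simeq> 1)"
    using cong_sym cong_trans by blast
  then have "(j' < 2 \<or> \<not> d) \<longleftrightarrow> (j < 2 \<or> \<not> d)"
    using all[of "\<lambda>k. rep d j' k * rep d j' k \<simeq> 1"] rep_quadratic_iff by simp
  with z show "kind d j' = kind d j" by (auto simp: kind_def)
qed

text \<open>The shear merges 3 into 2; for Z_2^2 exchanging the bits merges 2 into 1. The exchange
  does not fix a quadratic \<chi>, so it identifies groups but not the braces over them.\<close>

lemma iso_rep_kind: "split4 d (rep d j) \<cong> split4 d (rep d (kind d j))"
proof -
  have 3: "split4 d (rep d j) \<cong> split4 d (rep d 2)" if "j > 1"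
  proof (cases "j = 2")
    case True
    then show ?thesis by (simp add: iso_refl)
  next
    case False
    have "rep d j = rep d 3" using that False by (simp add: rep_def)
    moreover have "split4 d (rep d 3) \<cong> split4 d (rep d 2)"
      by (rule isoD[OF relabel_iso[OF bij_shear[of True] shear_bmult]]) (simp_all add: rep_3_shear)
    ultimately show ?thesis by (simp only:)
  qed
  have 2: "split4 False (rep False 2) \<cong> split4 False (rep False 1)"
  proof (rule isoD[OF relabel_iso])
    show "bij (prod.swap :: bits \<Rightarrow> bits)" by simp
    show "prod.swap (bmult False k m) = bmult False (prod.swap k) (prod.swap m)" for k m
      by (simp add: bmult_def)
    have "\<forall>k. rep False 1 (prod.swap k) = rep False 2 k"
      unfolding bits_exhaust by (simp add: rep_def)
    then have "rep False 1 (prod.swap k) = rep False 2 k" for k by blast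
    then show "rep False 1 (prod.swap k) \<simeq> rep False 2 k" for k by (simp only: cong_refl)
  qed simp
  show ?thesis
  proof (cases "j < 2")
    case True
    then show ?thesis by (simp add: kind_def iso_refl)
  next
    case False
    then show ?thesis using 3 iso_trans[OF 3, of "split4 False (rep False 1)"] 2
      by (cases d) (simp_all add: kind_def)
  qed
qed

lemma split4_rep_iso_iff:
  "split4 d (rep d j) \<cong> split4 d' (rep d' j') \<longleftrightarrow> d = d' \<and> kind d j = kind d' j'"
proof
  assume "split4 d (rep d j) \<cong> split4 d' (rep d' j')"
  then obtain f where f: "f \<in> iso (split4 d (rep d j)) (split4 d' (rep d' j'))" by (auto simp: is_iso_def)
  show "d = d' \<and> kind d j = kind d' j'"
  proof (rule iso_split4_form[OF char4_rep char4_rep f], goal_cases)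
    case (1 a t \<theta>)
    have "d' = d" by (rule bij_hom_extension_eq[OF 1(3,4)])
    moreover from this have "kind d j' = kind d j"
      using 1(5) by (intro rep_transfer(2)[OF 1(3)]) simp
    ultimately show ?case by simp
  qed
next
  assume eq: "d = d' \<and> kind d j = kind d' j'"
  have "split4 d' (rep d' (kind d' j')) \<cong> split4 d' (rep d' j')"
    by (rule group.iso_sym[OF group_twist iso_rep_kind]) (simp_all add: char4_rep)
  moreover have "split4 d (rep d j) \<cong> split4 d' (rep d' (kind d' j'))"
    using iso_rep_kind[of d j] unfolding conjunct2[OF eq] unfolding conjunct1[OF eq] .
  ultimately show "split4 d (rep d j) \<cong> split4 d' (rep d' j')"
    using iso_trans by blast
qed

definition model :: "(bits \<Rightarrow> int) \<Rightarrow> bool \<times> nat \<times> bool \<Rightarrow> (int \<times> bits) monoid" where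
  "model \<chi> = (\<lambda>(d, j, e). twist d (side e \<chi>) (\<lambda>k. rep d j k * side e \<chi> k))"

lemma model_simp: "model \<chi> (d, j, e) = twist d (side e \<chi>) (\<lambda>k. rep d j k * side e \<chi> k)"
  by (simp add: model_def)

text \<open>The system \<open>I\<close> of normal forms is independent of \<open>Y\<close>. By
  untwisting, the multiplicative type of a model is given by \<open>d\<close> and
  \<open>kind d j\<close>, so \<open>Y\<close> only selects these and leaves \<open>e\<close>
  alone.\<close>

lemma num_skew_braces_models:
  fixes I :: "(bool \<times> nat \<times> bool) set"
  assumes chi: "char4 c \<chi>" and nt: "\<not> \<chi> k1 \<simeq> 1"
    and sep: "\<And>k m. \<chi> k \<simeq> \<chi> m \<Longrightarrow> fst k = fst m"
    and ok: "\<And>d j e. (d, j, e) \<in> I \<Longrightarrow> char4 d \<chi> \<and> (d \<noteq> c \<longrightarrow> (\<forall>m. \<chi> (shear True m) \<simeq> \<chi> m))"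
    and all: "\<And>d j e. char4 d \<chi> \<Longrightarrow> d \<noteq> c \<longrightarrow> \<chi> (True, True) \<simeq> \<chi> (True, False) \<Longrightarrow> j < 4 \<Longrightarrow>
      \<exists>i\<in>I. skew_brace_isomorphic (split4 c \<chi>, model \<chi> (d, j, e)) (split4 c \<chi>, model \<chi> i)"
    and inj: "\<And>i i'. i \<in> I \<Longrightarrow> i' \<in> I \<Longrightarrow>
      skew_brace_isomorphic (split4 c \<chi>, model \<chi> i) (split4 c \<chi>, model \<chi> i') \<Longrightarrow> i = i'"
    and X: "split4 c \<chi> \<cong> X" and Y: "split4 d0 (rep d0 j0) \<cong> Y"
  shows "num_skew_braces X Y = card {(d, j, e) \<in> I. d = d0 \<and> kind d j = kind d0 j0}"
proof (rule num_skew_braces_eq_card[where M = "model \<chi>", OF X])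
  let ?Y = "split4 d0 (rep d0 j0)"
  have g0: "group ?Y" by (rule group_twist) (simp_all add: char4_rep)
  have modelY: "split4 d (rep d j) \<cong> model \<chi> (d, j, e)" if "(d, j, e) \<in> I" for d j e
    unfolding model_simp using ok[OF that] by (intro untwist_iso char4_side char4_rep) simp
  show "group (split4 c \<chi>)" by (rule group_twist) (simp_all add: chi)
  fix i assume "i \<in> {(d, j, e) \<in> I. d = d0 \<and> kind d j = kind d0 j0}"
  then obtain d j e where i: "i = (d, j, e)" "(d, j, e) \<in> I" and k: "d = d0" "kind d j = kind d0 j0" by auto
  note o = ok[OF i(2)]
  show "skew_brace (split4 c \<chi>) (model \<chi> i)"
    unfolding i model_simp using o
    by (intro skew_brace_twist chi char4_times char4_rep char4_side) auto
  have "group (split4 d (rep d j))" by (rule group_twist) (simp_all add: char4_rep)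
  then have "model \<chi> i \<cong> split4 d (rep d j)" unfolding i by (rule group.iso_sym[OF _ modelY[OF i(2)]])
  moreover have "split4 d (rep d j) \<cong> ?Y" using k by (simp add: split4_rep_iso_iff)
  ultimately show "model \<chi> i \<cong> Y" using Y iso_trans by blast
next
  show "i = i'" if "i \<in> {(d, j, e) \<in> I. d = d0 \<and> kind d j = kind d0 j0}"
    "i' \<in> {(d, j, e) \<in> I. d = d0 \<and> kind d j = kind d0 j0}"
    "skew_brace_isomorphic (split4 c \<chi>, model \<chi> i) (split4 c \<chi>, model \<chi> i')" for i i'
    using inj that by blast
next
  let ?Y = "split4 d0 (rep d0 j0)"
  fix C assume B: "skew_brace (split4 c \<chi>) C" and CY: "C \<cong> Y"
  interpret skew_brace "split4 c \<chi>" C by fact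
  have "Y \<cong> ?Y" by (rule group.iso_sym[OF group_twist Y]) (simp_all add: char4_rep)
  then have CY0: "C \<cong> ?Y" using CY iso_trans by blast
  show "\<exists>i\<in>{(d, j, e) \<in> I. d = d0 \<and> kind d j = kind d0 j0}.
      skew_brace_isomorphic (split4 c \<chi>, C) (split4 c \<chi>, model \<chi> i)"
  proof (rule skew_brace_structure[OF chi nt sep B char4_rep CY0], goal_cases)
    case (2 d e \<alpha> f)
    let ?w = "side e \<chi>"
    have w: "char4 d ?w" using 2(1) by (rule char4_side)
    \<comment> \<open>The cube of \<open>?w\<close> is its inverse: dividing \<alpha> by
      \<open>?w\<close> recovers the character of the untwisted extension.\<close>
    have psi: "char4 d (\<lambda>k. \<alpha> k * ?w k ^ 3)" by (intro char4_times char4_power w 2(2))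
    obtain j where j: "j < 4" "\<And>k. \<alpha> k * ?w k ^ 3 \<simeq> rep d j k" using rep_exhaust[OF psi] by blast
    have "\<alpha> k \<simeq> rep d j k * ?w k" for k
      by (rule cong_linear2[OF j(2)[of k] char4_pow4[OF w, of k], of _ _ "?w k" "- \<alpha> k"])
        (simp add: algebra_simps eval_nat_numeral)
    then have "twist d ?w \<alpha> = model \<chi> (d, j, e)" unfolding model_simp by (intro twist_cong) auto
    then have "f \<in> iso C (model \<chi> (d, j, e))" using 2(4) by (simp add: side_def)
    then have 1: "skew_brace_isomorphic (split4 c \<chi>, C) (split4 c \<chi>, model \<chi> (d, j, e))"
      using 2(3) by (auto simp: skew_brace_isomorphic_def)
    obtain i where i: "i \<in> I"
      "skew_brace_isomorphic (split4 c \<chi>, model \<chi> (d, j, e)) (split4 c \<chi>, model \<chi> i)"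
      using all[OF 2(1) _ j(1)] 2(5) by blast
    have Ci: "skew_brace_isomorphic (split4 c \<chi>, C) (split4 c \<chi>, model \<chi> i)"
      by (rule skew_brace_isomorphic_trans[OF 1 i(2)])
    obtain d' j' e' where i': "i = (d', j', e')" by (cases i)
    have "C \<cong> model \<chi> i" using Ci by (auto simp: skew_brace_isomorphic_def is_iso_def)
    moreover have "split4 d' (rep d' j') \<cong> model \<chi> i"
      unfolding i' model_simp using ok i(1) i' by (intro untwist_iso char4_side char4_rep) blast
    ultimately have "split4 d' (rep d' j') \<cong> ?Y"
      using CY0 iso_trans circ.iso_sym by blast
    then have "d' = d0 \<and> kind d' j' = kind d0 j0" unfolding split4_rep_iso_iff .
    then show ?case using i(1) i' Ci by blast
  qed simp
qed

text \<open>Here \<chi> sees the first bit only, so it is a character for either carry and is fixed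
  by the shear: \<open>d\<close> is free and index 3 is folded into 2. For \<open>d = False\<close>
  the indices 1 and 2 remain different although their groups agree.\<close>

lemma num_skew_braces_quadratic:
  assumes X: "split4 c (chr (-1) 1) \<cong> X" and Y: "split4 d0 (rep d0 j0) \<cong> Y"
  shows "num_skew_braces X Y =
    card {(d, j, e) \<in> UNIV \<times> {..<3} \<times> (UNIV :: bool set). d = d0 \<and> kind d j = kind d0 j0}"
proof (rule num_skew_braces_models[OF _ _ _ _ _ _ X Y])
  let ?\<chi> = "chr (-1) 1"
  have chi: "char4 d ?\<chi>" for d by (rule char4_chr) simp_all
  show "char4 c ?\<chi>" by (rule chi)
  show nt: "\<not> ?\<chi> (True, False) \<simeq> 1" by (simp add: roots_distinct)
  have "\<forall>k m. ?\<chi> k \<simeq> ?\<chi> m \<longrightarrow> fst k = fst m"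
    unfolding bits_exhaust by (simp add: roots_distinct)
  then show sep: "?\<chi> k \<simeq> ?\<chi> m \<Longrightarrow> fst k = fst m" for k m by blast
  have sh: "?\<chi> (shear z m) \<simeq> ?\<chi> m" for z m by (simp add: chr_def shear_def)
  then show "char4 d ?\<chi> \<and> (d \<noteq> c \<longrightarrow> (\<forall>m. ?\<chi> (shear True m) \<simeq> ?\<chi> m))" for d using chi by blast
  let ?I = "UNIV \<times> {..<3::nat} \<times> (UNIV :: bool set)"
  show "\<exists>i\<in>?I. skew_brace_isomorphic (split4 c ?\<chi>, model ?\<chi> (d, j, e)) (split4 c ?\<chi>, model ?\<chi> i)"
    if "j < 4" for d j e
  proof (cases "j = 3")
    case True
    let ?F = "\<lambda>(x, k). (x, shear True k)"
    have "?F \<in> iso (split4 c ?\<chi>) (split4 c ?\<chi>)"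
      by (rule relabel_iso[OF bij_shear shear_bmult]) (simp_all add: sh)
    moreover have "?F \<in> iso (model ?\<chi> (d, 3, e)) (model ?\<chi> (d, 2, e))"
      unfolding model_simp
      by (rule relabel_iso[OF bij_shear shear_bmult]) (auto simp: side_def intro!: cong_mult sh rep_3_shear)
    ultimately show ?thesis using True
      by (intro bexI[of _ "(d, 2, e)"]) (auto simp: skew_brace_isomorphic_def)
  next
    case False
    then show ?thesis using that skew_brace_isomorphic_refl by (intro bexI[of _ "(d, j, e)"]) auto
  qed
  fix i i' assume "i \<in> ?I" "i' \<in> ?I"
    and iso: "skew_brace_isomorphic (split4 c ?\<chi>, model ?\<chi> i) (split4 c ?\<chi>, model ?\<chi> i')"
  then obtain d j e d' j' e' where i: "i = (d, j, e)" "i' = (d', j', e')" and j: "j < 3" "j' < 3" by auto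
  show "i = i'"
  proof (rule twist_isomorphic_form[OF chi nt char4_side[OF chi] char4_rep char4_rep
        iso[unfolded i model_simp]], goal_cases)
    case (1 \<theta>)
    have d: "d' = d" by (rule bij_hom_extension_eq[OF 1(1,3)])
    have r: "rep d j' (\<theta> k) \<simeq> rep d j k" for k using 1(5) d by simp
    obtain z where z: "\<And>k. \<theta> k = shear z k" using hom_eq_shear[OF 1(1,2) sep[OF 1(4)]] by blast
    \<comment> \<open>Every shear fixes \<open>(False, True)\<close>, and among the indices below 3
      only 2 takes the value -1 there.\<close>
    have "rep d j' (False, True) \<simeq> rep d j (False, True)" using r[of "(False, True)"] by (simp add: z shear_def)
    then have "j' = 2 \<longleftrightarrow> j = 2" using j by (auto simp: rep_def roots_distinct split: if_splits)
    moreover have "j' = 0 \<longleftrightarrow> j = 0" by (rule rep_transfer(1)[OF 1(1) r])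
    ultimately have "j' = j" using j by linarith
    then show ?case using d 1(6) i by simp
  qed
qed

text \<open>Here \<chi> separates all four elements, so only the identity of K preserves it: the
  carry cannot change, and no two of the four characters are merged.\<close>

lemma num_skew_braces_quartic:
  assumes X: "split4 True (chr h (-1)) \<cong> X" and Y: "split4 d0 (rep d0 j0) \<cong> Y"
  shows "num_skew_braces X Y =
    card {(d, j, e) \<in> {True} \<times> {..<4} \<times> (UNIV :: bool set). d = d0 \<and> kind d j = kind d0 j0}"
proof (rule num_skew_braces_models[OF _ _ _ _ _ _ X Y])
  let ?\<chi> = "chr h (-1)"
  show chi: "char4 True ?\<chi>" by (rule char4_chr) (simp_all add: h_square)
  show nt: "\<not> ?\<chi> (True, False) \<simeq> 1" by (simp add: roots_distinct)
  have "\<forall>k m. ?\<chi> k \<simeq> ?\<chi> m \<longrightarrow> k = m"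
    unfolding bits_exhaust by (simp add: roots_distinct)
  then have inj: "?\<chi> k \<simeq> ?\<chi> m \<Longrightarrow> k = m" for k m by blast
  then show "?\<chi> k \<simeq> ?\<chi> m \<Longrightarrow> fst k = fst m" for k m by blast
  let ?I = "{True} \<times> {..<4::nat} \<times> (UNIV :: bool set)"
  show "char4 d ?\<chi> \<and> (d \<noteq> True \<longrightarrow> (\<forall>m. ?\<chi> (shear True m) \<simeq> ?\<chi> m))" if "(d, j, e) \<in> ?I" for d j e
    using that chi by simp
  show "\<exists>i\<in>?I. skew_brace_isomorphic (split4 True ?\<chi>, model ?\<chi> (d, j, e)) (split4 True ?\<chi>, model ?\<chi> i)"
    if "j < 4" "d \<noteq> True \<longrightarrow> ?\<chi> (True, True) \<simeq> ?\<chi> (True, False)" for d j e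
    using that inj[of "(True, True)" "(True, False)"] skew_brace_isomorphic_refl
    by (intro bexI[of _ "(d, j, e)"]) auto
  fix i i' assume "i \<in> ?I" "i' \<in> ?I"
    and iso: "skew_brace_isomorphic (split4 True ?\<chi>, model ?\<chi> i) (split4 True ?\<chi>, model ?\<chi> i')"
  then obtain j e j' e' where i: "i = (True, j, e)" "i' = (True, j', e')" and j: "j < 4" "j' < 4" by auto
  show "i = i'"
  proof (rule twist_isomorphic_form[OF chi nt char4_side[OF chi] char4_rep char4_rep
        iso[unfolded i model_simp]], goal_cases)
    case (1 \<theta>)
    have "rep True j' (True, False) \<simeq> rep True j (True, False)"
      using 1(5)[of "(True, False)"] inj[OF 1(4)] by simp
    then have "j' = j" using j
      by (auto simp: rep_def roots_distinct split: if_splits)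
    then show ?case using 1(6) i by simp
  qed
qed

lemma card_filter:
  assumes "finite D" "finite J"
  shows "card {(d, j, e) \<in> D \<times> J \<times> (UNIV :: bool set). P d j} = (\<Sum>d\<in>D. \<Sum>j\<in>J. 2 * of_bool (P d j))"
proof -
  let ?I = "D \<times> J \<times> (UNIV :: bool set)"
  have "{(d, j, e) \<in> ?I. P d j} = ?I \<inter> {i. P (fst i) (fst (snd i))}" by auto
  then have "card {(d, j, e) \<in> ?I. P d j} = (\<Sum>i\<in>?I. of_bool (P (fst i) (fst (snd i))))"
    using assms by (simp add: sum_of_bool_eq)
  also have "\<dots> = (\<Sum>d\<in>D. \<Sum>j\<in>J. \<Sum>e\<in>(UNIV :: bool set). of_bool (P d j))"
    by (simp add: sum.cartesian_product' case_prod_beta')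
  finally show ?thesis by (simp add: UNIV_bool mult_2)
qed

end

section \<open>Identification of the five groups and evaluation of the counts\<close>

theorem mainTheorem8:
  fixes q :: nat and h :: int
  assumes "prime q" and "q mod 4 = 1"
    and "h \<in> carrier (units_of (residue_ring (int q)))"
    and "group.ord (units_of (residue_ring (int q))) h = 4"
  defines "Cyc \<equiv> integer_mod_group (4 * q)"
    and "Ab \<equiv> (integer_mod_group 2 \<times>\<times> integer_mod_group 2) \<times>\<times> integer_mod_group q"
    and "Dic \<equiv> cyclic_semidirect q 4 (-1)"
    and "Frob \<equiv> cyclic_semidirect q 4 h"
    and "Dih \<equiv> integer_mod_group 2 \<times>\<times> cyclic_semidirect q 2 (-1)"
  shows
    "num_skew_braces Dic Cyc = 2 \<and>
     num_skew_braces Dic Dic = 2 \<and>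
     num_skew_braces Dic Frob = 2 \<and>
     num_skew_braces Dic Ab = 2 \<and>
     num_skew_braces Dic Dih = 4 \<and>
     num_skew_braces Dih Cyc = 2 \<and>
     num_skew_braces Dih Dic = 2 \<and>
     num_skew_braces Dih Frob = 2 \<and>
     num_skew_braces Dih Ab = 2 \<and>
     num_skew_braces Dih Dih = 4 \<and>
     num_skew_braces Frob Cyc = 2 \<and>
     num_skew_braces Frob Dic = 2 \<and>
     num_skew_braces Frob Frob = 4 \<and>
     num_skew_braces Frob Ab = 0 \<and>
     num_skew_braces Frob Dih = 0"
proof -
  interpret prime_1_mod_4 q using assms(1,2) by unfold_locales
  interpret R: residues "int q" "residue_ring (int q)"
    using q_ge by unfold_locales simp_all
  let ?U = "units_of (residue_ring (int q))"
  interpret U: group ?U by (rule R.units_group)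
  have hU: "h \<in> Units (residue_ring (int q))" using assms(3) by (simp add: units_of_def)
  have h: "0 \<le> h" "h < int q"
    using hU R.Units_closed by (auto simp: R.res_carrier_eq)
  have pow: "h [^]\<^bsub>?U\<^esub> n = h ^ n mod int q" for n :: nat
    using R.units_of_pow[OF hU] R.pow_cong[of h n] h by simp
  have one: "\<one>\<^bsub>?U\<^esub> = 1" by (simp add: units_of_def R.res_one_eq)
  have pow_iff: "h ^ n \<simeq> 1 \<longleftrightarrow> 4 dvd n" for n :: nat
    using U.pow_eq_id[OF assms(3), of n] q_ge by (simp add: pow one assms(4) cong_def)
  have "h ^ 4 \<simeq> 1" "\<not> h ^ 2 \<simeq> 1" by (simp_all add: pow_iff)
  moreover have "h ^ 4 = (h * h) * (h * h)" "h ^ 2 = h * h" by (simp_all add: eval_nat_numeral)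
  \<comment> \<open>The square of \<open>h * h\<close> is 1, which leaves 1 and -1; order 4 excludes
    1.\<close>
  ultimately have "h * h \<simeq> - 1" using cong_square_eq[of "h * h" 1] by auto
  then interpret prime_1_mod_4_root q h by unfold_locales
  have Cyc: "split4 True (rep True 0) \<cong> Cyc"
  proof -
    have "chr 1 1 = (\<lambda>_. 1)" by (simp add: chr_def fun_eq_iff)
    then show ?thesis using integer_mod_group_iso_split4 by (simp add: rep_def Cyc_def)
  qed
  have Ab: "split4 False (rep False 0) \<cong> Ab"
  proof -
    have "chr 1 1 = (\<lambda>_. 1)" by (simp add: chr_def fun_eq_iff)
    then show ?thesis using product_iso_split4 by (simp add: rep_def Ab_def)
  qed
  have Dic: "split4 True (rep True 1) \<cong> Dic" "split4 True (chr (-1) 1) \<cong> Dic"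
    using cyclic_semidirect_iso_split4[of "-1"] by (simp_all add: rep_def Dic_def)
  have Dih: "split4 False (rep False 1) \<cong> Dih" "split4 False (chr (-1) 1) \<cong> Dih"
    using dihedral_product_iso_split4 by (simp_all add: rep_def Dih_def)
  \<comment> \<open>The standard character has -1 at \<open>(False, True)\<close>, the semidirect
    product has \<open>h ^ 2\<close>; only residues matter.\<close>
  have "split4 True (chr h (-1)) = split4 True (chr h (h ^ 2))"
    by (intro twist_cong chr_cong) (use h_square cong_sym in \<open>auto simp: power2_eq_square\<close>)
  then have Frob: "split4 True (rep True 2) \<cong> Frob" "split4 True (chr h (-1)) \<cong> Frob"
    using cyclic_semidirect_iso_split4[of h] \<open>h ^ 4 \<simeq> 1\<close> by (simp_all add: rep_def Frob_def)
  have sets: "{..<3::nat} = {0, 1, 2}" "{..<4::nat} = {0, 1, 2, 3}" by auto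
  note quadratic = num_skew_braces_quadratic[OF Dic(2), unfolded card_filter[OF finite finite_lessThan]]
    num_skew_braces_quadratic[OF Dih(2), unfolded card_filter[OF finite finite_lessThan]]
  note quartic = num_skew_braces_quartic[OF Frob(2), unfolded card_filter[OF finite finite_lessThan]]
  show ?thesis
    unfolding quadratic[OF Cyc] quadratic[OF Dic(1)] quadratic[OF Frob(1)] quadratic[OF Ab] quadratic[OF Dih(1)]
      quartic[OF Cyc] quartic[OF Dic(1)] quartic[OF Frob(1)] quartic[OF Ab] quartic[OF Dih(1)]
    by (simp add: UNIV_bool sets kind_def)
qed

end
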